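(* Let $N$ be an $A$-definable normal subgroup of $G$, let $\Phi\in Z^1_{\mathrm{def}}(\mathcal G,G)$ and let $\mu\in H^1_{\mathrm{def}}(\mathcal G,G)$ be the cohomology class of $\Phi$. Then there is a natural bijection, induced by $[\Psi]\mapsto[\Psi\cdot\Phi]$ where $(\Psi\cdot\Phi)(\sigma)=\Psi(\sigma)\cdot\Phi(\sigma)$, between $\ker(\pi^1_\Phi)$ and the fibre $$\mathfrak P(\mu):=(\pi^1)^{-1}(\pi^1(\mu)).$$
   Context: Setting. Fix a first-order structure $M$ and a subset $A$ of $M$ such that: (i) $M$ is atomic over $A$, i.e. for every finite tuple $a$ from $M$ the type $\mathrm{tp}(a/A)$ is isolated; (ii) for all finite tuples $a,b$ from $M$ with $\mathrm{tp}(a/A)=\mathrm{tp}(b/A)$ there is $\sigma\in\mathrm{Aut}(M/A)$ with $\sigma(a)=b$; (iii) the theory of $M$ eliminates imaginaries (so $G/N$ is identified with an $A$-definable group). Put $\mathcal G=\mathrm{Aut}(M/A)$. $G$ is an arbitrary group definable in $M$ with parameters from $A$; $\mathcal G$ acts on $G$ by group automorphisms. "$A$-definable" means definable in $M$ with parameters from $A$. Tuples are finite. Definable cohomology. For an $A$-definable group $G$, a definable cocycle from $\mathcal G$ to $G$ is a map $\Phi:\mathcal G\to G$ with $\Phi(\sigma_1\sigma_2)=\Phi(\sigma_1)\cdot\sigma_1(\Phi(\sigma_2))$ for which there are a tuple $a$ from $M$ and an $A$-definable (partial) function $h(x,y)$ with $\Phi(\sigma)=h(a,\sigma(a))$ for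 all $\sigma\in\mathcal G$. The set of these is $Z^1_{\mathrm{def}}(\mathcal G,G)$. $\Phi$ and $\Psi$ are cohomologous if there is $b\in G$ with $\Psi(\sigma)=b^{-1}\Phi(\sigma)\sigma(b)$ for all $\sigma$. $H^1_{\mathrm{def}}(\mathcal G,G)$ is the set of equivalence classes, pointed by the class of the trivial cocycle. Let $\pi:G\to G/N$ be the projection and $\pi^1:H^1_{\mathrm{def}}(\mathcal G,G)\to H^1_{\mathrm{def}}(\mathcal G,G/N)$, $[\Phi]\mapsto[\pi\circ\Phi]$. Twisting. Given $\Phi\in Z^1_{\mathrm{def}}(\mathcal G,G)$, the twisted action of $\mathcal G$ on $G$ is $\sigma*g=\Phi(\sigma)\,\sigma(g)\,\Phi(\sigma)^{-1}$; write $\mathcal G_\Phi$ for $\mathcal G$ with this action. The twisted action on $G/N$ is defined likewise using the cocycle $\pi\circ\Phi$. For $X$ equal to $G$ or $G/N$, $Z^1_{\mathrm{def}}(\mathcal G_\Phi,X)$ is the set of maps $\Psi:\mathcal G\to X$ with $\Psi(\sigma_1\sigma_2)=\Psi(\sigma_1)\cdot(\sigma_1*\Psi(\sigma_2))$ that are definable (i.e. $\Psi(\sigma)=h(a,\sigma(a))$ for all $\sigma\in\mathcal G$, for some tuple $a$ from $M$ and $A$-definable function $h$). $\Psi,\Lambda$ are cohomologous if there is $b\in X$ with $\Psi(\sigma)=b^{-1}\Lambda(\sigma)(\sigma*b)$ for all $\sigma$; $H^1_{\mathrm{def}}(\mathcal G_\Phi,X)$ is the set of classes, pointed by the class of the trivial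 cocycle. The map $\pi^1_\Phi:H^1_{\mathrm{def}}(\mathcal G_\Phi,G)\to H^1_{\mathrm{def}}(\mathcal G_\Phi,G/N)$ is $[\Psi]\mapsto[\pi\circ\Psi]$, and $\ker(\pi^1_\Phi)$ is the preimage of the distinguished element. *)

theory Defs
  imports "HOL-Algebra.Coset"
begin

text \<open>
  One-sorted first-order structures whose universe is the type \<open>'m\<close>. The symbols of the language
  are the elements of the domains of the two arity maps, so the language may lack function symbols
  or relation symbols although HOL types are never empty. Values of the interpretations at
  non-symbols or at lists of the wrong length are irrelevant.
\<close>

record ('f, 'r, 'm) fo_structure =
  fun_arity :: "'f \<rightharpoonup> nat"
  rel_arity :: "'r \<rightharpoonup> nat"
  fun_interp :: "'f \<Rightarrow> 'm list \<Rightarrow> 'm"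
  rel_interp :: "'r \<Rightarrow> 'm list \<Rightarrow> bool"

text \<open>
  Terms and formulas of the language expanded by a constant \<open>Const c\<close> for every element
  \<open>c\<close> of the universe; those over a parameter set \<open>A\<close> are singled out by the
  generated functions \<open>tm_consts\<close>, \<open>fm_consts\<close>.
\<close>

datatype ('f, tm_consts: 'm) tm =
    Var nat
  | Const 'm
  | Fun 'f "('f, 'm) tm list"

datatype ('f, 'r, fm_consts: 'm) fm =
    Eq "('f, 'm) tm" "('f, 'm) tm"
  | Rel 'r "('f, 'm) tm list"
  | Neg "('f, 'r, 'm) fm"
  | Conj "('f, 'r, 'm) fm" "('f, 'r, 'm) fm"
  | Ex nat "('f, 'r, 'm) fm"

fun tm_vars :: "('f, 'm) tm \<Rightarrow> nat set" where
  "tm_vars (Var i) = {i}"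
| "tm_vars (Const c) = {}"
| "tm_vars (Fun f ts) = (\<Union>t\<in>set ts. tm_vars t)"

primrec fm_free_vars :: "('f, 'r, 'm) fm \<Rightarrow> nat set" where
  "fm_free_vars (Eq s t) = tm_vars s \<union> tm_vars t"
| "fm_free_vars (Rel r ts) = (\<Union>t\<in>set ts. tm_vars t)"
| "fm_free_vars (Neg \<phi>) = fm_free_vars \<phi>"
| "fm_free_vars (Conj \<phi> \<psi>) = fm_free_vars \<phi> \<union> fm_free_vars \<psi>"
| "fm_free_vars (Ex i \<phi>) = fm_free_vars \<phi> - {i}"

fun tm_wf :: "('f, 'r, 'm) fo_structure \<Rightarrow> ('f, 'm) tm \<Rightarrow> bool" where
  "tm_wf M (Var i) = True"
| "tm_wf M (Const c) = True"
| "tm_wf M (Fun f ts) = (fun_arity M f = Some (length ts) \<and> (\<forall>t\<in>set ts. tm_wf M t))"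

primrec fm_wf :: "('f, 'r, 'm) fo_structure \<Rightarrow> ('f, 'r, 'm) fm \<Rightarrow> bool" where
  "fm_wf M (Eq s t) = (tm_wf M s \<and> tm_wf M t)"
| "fm_wf M (Rel r ts) = (rel_arity M r = Some (length ts) \<and> (\<forall>t\<in>set ts. tm_wf M t))"
| "fm_wf M (Neg \<phi>) = fm_wf M \<phi>"
| "fm_wf M (Conj \<phi> \<psi>) = (fm_wf M \<phi> \<and> fm_wf M \<psi>)"
| "fm_wf M (Ex i \<phi>) = fm_wf M \<phi>"

primrec tm_val :: "('f, 'r, 'm) fo_structure \<Rightarrow> (nat \<Rightarrow> 'm) \<Rightarrow> ('f, 'm) tm \<Rightarrow> 'm" where
  "tm_val M v (Var i) = v i"
| "tm_val M v (Const c) = c"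
| "tm_val M v (Fun f ts) = fun_interp M f (map (tm_val M v) ts)"

primrec sat :: "('f, 'r, 'm) fo_structure \<Rightarrow> (nat \<Rightarrow> 'm) \<Rightarrow> ('f, 'r, 'm) fm \<Rightarrow> bool" where
  "sat M v (Eq s t) = (tm_val M v s = tm_val M v t)"
| "sat M v (Rel r ts) = rel_interp M r (map (tm_val M v) ts)"
| "sat M v (Neg \<phi>) = (\<not> sat M v \<phi>)"
| "sat M v (Conj \<phi> \<psi>) = (sat M v \<phi> \<and> sat M v \<psi>)"
| "sat M v (Ex i \<phi>) = (\<exists>c. sat M (v(i := c)) \<phi>)"

text \<open>The formulas over \<open>A\<close> in the variables \<open>x\<^sub>0, \<dots>, x\<^sub>n\<^sub>-\<^sub>1\<close>, and
  satisfaction of such a formula by an \<open>n\<close>-tuple. Tuples are lists.\<close>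

definition formulas :: "('f, 'r, 'm) fo_structure \<Rightarrow> 'm set \<Rightarrow> nat \<Rightarrow> ('f, 'r, 'm) fm set" where
  "formulas M A n = {\<phi>. fm_wf M \<phi> \<and> fm_consts \<phi> \<subseteq> A \<and> fm_free_vars \<phi> \<subseteq> {..<n}}"

definition holds :: "('f, 'r, 'm) fo_structure \<Rightarrow> ('f, 'r, 'm) fm \<Rightarrow> 'm list \<Rightarrow> bool" where
  "holds M \<phi> a \<longleftrightarrow> sat M (\<lambda>i. a ! i) \<phi>"

definition tuples :: "nat \<Rightarrow> 'm list set" where
  "tuples n = {a. length a = n}"

definition definable_set ::
    "('f, 'r, 'm) fo_structure \<Rightarrow> 'm set \<Rightarrow> nat \<Rightarrow> 'm list set \<Rightarrow> bool" where
  "definable_set M A n X \<longleftrightarrow> (\<exists>\<phi>\<in>formulas M A n. X = {a \<in> tuples n. holds M \<phi> a})"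

text \<open>\<open>f\<close>, restricted to \<open>D\<close>, is an \<open>A\<close>-definable function from a subset of
  \<open>M\<^sup>n\<close> to \<open>M\<^sup>k\<close>. Partial definable functions are obtained by varying \<open>D\<close>.\<close>

definition definable_fun ::
    "('f, 'r, 'm) fo_structure \<Rightarrow> 'm set \<Rightarrow> nat \<Rightarrow> nat \<Rightarrow> 'm list set \<Rightarrow> ('m list \<Rightarrow> 'm list) \<Rightarrow> bool"
  where
  "definable_fun M A n k D f \<longleftrightarrow>
     D \<subseteq> tuples n \<and> f ` D \<subseteq> tuples k \<and> definable_set M A (n + k) {x @ f x |x. x \<in> D}"

definition tp :: "('f, 'r, 'm) fo_structure \<Rightarrow> 'm set \<Rightarrow> 'm list \<Rightarrow> ('f, 'r, 'm) fm set" where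
  "tp M A a = {\<phi> \<in> formulas M A (length a). holds M \<phi> a}"

definition isolated_tp :: "('f, 'r, 'm) fo_structure \<Rightarrow> 'm set \<Rightarrow> 'm list \<Rightarrow> bool" where
  "isolated_tp M A a \<longleftrightarrow>
     (\<exists>\<phi>\<in>tp M A a. \<forall>\<psi>\<in>tp M A a. \<forall>c\<in>tuples (length a). holds M \<phi> c \<longrightarrow> holds M \<psi> c)"

definition atomic_over :: "('f, 'r, 'm) fo_structure \<Rightarrow> 'm set \<Rightarrow> bool" where
  "atomic_over M A \<longleftrightarrow> (\<forall>a. isolated_tp M A a)"

definition Aut :: "('f, 'r, 'm) fo_structure \<Rightarrow> 'm set \<Rightarrow> ('m \<Rightarrow> 'm) set" where
  "Aut M A = {\<sigma>. bij \<sigma>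
     \<and> (\<forall>f xs. fun_arity M f = Some (length xs) \<longrightarrow>
          \<sigma> (fun_interp M f xs) = fun_interp M f (map \<sigma> xs))
     \<and> (\<forall>r xs. rel_arity M r = Some (length xs) \<longrightarrow>
          rel_interp M r (map \<sigma> xs) = rel_interp M r xs)
     \<and> (\<forall>a\<in>A. \<sigma> a = a)}"

definition homogeneous_over :: "('f, 'r, 'm) fo_structure \<Rightarrow> 'm set \<Rightarrow> bool" where
  "homogeneous_over M A \<longleftrightarrow> (\<forall>a b. tp M A a = tp M A b \<longrightarrow> (\<exists>\<sigma>\<in>Aut M A. map \<sigma> a = b))"

text \<open>Elimination of imaginaries for the theory of \<open>M\<close>: every \<open>\<emptyset>\<close>-definable equivalence
  relation on some \<open>M\<^sup>n\<close> is the kernel of a \<open>\<emptyset>\<close>-definable function. For fixed formulas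
  defining the relation and the function this is a first-order sentence, so that it holds in
  \<open>M\<close> iff it holds in all models of the theory of \<open>M\<close>.\<close>

definition eliminates_imaginaries :: "('f, 'r, 'm) fo_structure \<Rightarrow> bool" where
  "eliminates_imaginaries M \<longleftrightarrow>
     (\<forall>n E. equiv (tuples n) E \<and> definable_set M {} (n + n) {x @ y |x y. (x, y) \<in> E} \<longrightarrow>
        (\<exists>k f. definable_fun M {} n k (tuples n) f
             \<and> (\<forall>x\<in>tuples n. \<forall>y\<in>tuples n. (x, y) \<in> E \<longleftrightarrow> f x = f y)))"

definition definable_group :: "('f, 'r, 'm) fo_structure \<Rightarrow> 'm set \<Rightarrow> 'm list monoid \<Rightarrow> bool" where
  "definable_group M A G \<longleftrightarrow> group G \<and>
     (\<exists>n. definable_set M A n (carrier G)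
        \<and> definable_set M A (n + n + n)
            {x @ y @ (x \<otimes>\<^bsub>G\<^esub> y) |x y. x \<in> carrier G \<and> y \<in> carrier G})"

definition definable_normal_subgroup ::
    "('f, 'r, 'm) fo_structure \<Rightarrow> 'm set \<Rightarrow> 'm list monoid \<Rightarrow> 'm list set \<Rightarrow> bool" where
  "definable_normal_subgroup M A G N \<longleftrightarrow> N \<lhd> G \<and> (\<exists>n. definable_set M A n N)"

text \<open>An identification of \<open>G/N\<close> with an \<open>A\<close>-definable group \<open>Q\<close>, given by the
  projection \<open>\<pi>\<close>. It exists under elimination of imaginaries, see
  \<open>definable_quotient_exists\<close> below.\<close>

definition definable_quotient ::
    "('f, 'r, 'm) fo_structure \<Rightarrow> 'm set \<Rightarrow> 'm list monoid \<Rightarrow> 'm list set \<Rightarrow> 'm list monoid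
      \<Rightarrow> ('m list \<Rightarrow> 'm list) \<Rightarrow> bool" where
  "definable_quotient M A G N Q \<pi> \<longleftrightarrow>
     definable_group M A Q \<and> (\<exists>n k. definable_fun M A n k (carrier G) \<pi>)
     \<and> \<pi> \<in> epi G Q \<and> kernel G Q \<pi> = N"

text \<open>
  Definable cohomology of \<open>Aut M A\<close> with values in a group \<open>X\<close> of tuples, relative to an
  action \<open>act\<close> of \<open>Aut M A\<close> on \<open>X\<close>: either \<open>map\<close>, the coordinatewise action, or one of
  its twists. Cochains are extensional functions on \<open>Aut M A\<close>.
\<close>

definition definable_Z1 :: "('f, 'r, 'm) fo_structure \<Rightarrow> 'm set \<Rightarrow> 'm list monoid
    \<Rightarrow> (('m \<Rightarrow> 'm) \<Rightarrow> 'm list \<Rightarrow> 'm list) \<Rightarrow> (('m \<Rightarrow> 'm) \<Rightarrow> 'm list) set" where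
  "definable_Z1 M A X act = {\<Phi> \<in> Aut M A \<rightarrow>\<^sub>E carrier X.
     (\<forall>\<sigma>\<in>Aut M A. \<forall>\<tau>\<in>Aut M A. \<Phi> (\<sigma> \<circ> \<tau>) = \<Phi> \<sigma> \<otimes>\<^bsub>X\<^esub> act \<sigma> (\<Phi> \<tau>))
     \<and> (\<exists>a k D h. definable_fun M A (length a + length a) k D h
          \<and> (\<forall>\<sigma>\<in>Aut M A. a @ map \<sigma> a \<in> D \<and> \<Phi> \<sigma> = h (a @ map \<sigma> a)))}"

definition cohomologous :: "('f, 'r, 'm) fo_structure \<Rightarrow> 'm set \<Rightarrow> 'm list monoid
    \<Rightarrow> (('m \<Rightarrow> 'm) \<Rightarrow> 'm list \<Rightarrow> 'm list) \<Rightarrow> ((('m \<Rightarrow> 'm) \<Rightarrow> 'm list) \<times> (('m \<Rightarrow> 'm) \<Rightarrow> 'm list)) set" where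
  "cohomologous M A X act = {(\<Phi>, \<Psi>). \<Phi> \<in> definable_Z1 M A X act \<and> \<Psi> \<in> definable_Z1 M A X act
     \<and> (\<exists>b\<in>carrier X. \<forall>\<sigma>\<in>Aut M A. \<Psi> \<sigma> = inv\<^bsub>X\<^esub> b \<otimes>\<^bsub>X\<^esub> \<Phi> \<sigma> \<otimes>\<^bsub>X\<^esub> act \<sigma> b)}"

definition definable_H1 :: "('f, 'r, 'm) fo_structure \<Rightarrow> 'm set \<Rightarrow> 'm list monoid
    \<Rightarrow> (('m \<Rightarrow> 'm) \<Rightarrow> 'm list \<Rightarrow> 'm list) \<Rightarrow> (('m \<Rightarrow> 'm) \<Rightarrow> 'm list) set set" where
  "definable_H1 M A X act = definable_Z1 M A X act // cohomologous M A X act"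

definition H1_class :: "('f, 'r, 'm) fo_structure \<Rightarrow> 'm set \<Rightarrow> 'm list monoid
    \<Rightarrow> (('m \<Rightarrow> 'm) \<Rightarrow> 'm list \<Rightarrow> 'm list) \<Rightarrow> (('m \<Rightarrow> 'm) \<Rightarrow> 'm list) \<Rightarrow> (('m \<Rightarrow> 'm) \<Rightarrow> 'm list) set" where
  "H1_class M A X act \<Phi> = cohomologous M A X act `` {\<Phi>}"

definition H1_point :: "('f, 'r, 'm) fo_structure \<Rightarrow> 'm set \<Rightarrow> 'm list monoid
    \<Rightarrow> (('m \<Rightarrow> 'm) \<Rightarrow> 'm list \<Rightarrow> 'm list) \<Rightarrow> (('m \<Rightarrow> 'm) \<Rightarrow> 'm list) set" where
  "H1_point M A X act = H1_class M A X act (\<lambda>\<sigma>\<in>Aut M A. \<one>\<^bsub>X\<^esub>)"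

text \<open>The map \<open>[\<Phi>] \<mapsto> [\<pi> \<circ> \<Phi>]\<close> into the cohomology of \<open>Q\<close> with action \<open>act\<close>: the union
  runs over the representatives of a class, all of which give the same class.\<close>

definition H1_map :: "('f, 'r, 'm) fo_structure \<Rightarrow> 'm set \<Rightarrow> 'm list monoid
    \<Rightarrow> (('m \<Rightarrow> 'm) \<Rightarrow> 'm list \<Rightarrow> 'm list) \<Rightarrow> ('m list \<Rightarrow> 'm list)
    \<Rightarrow> (('m \<Rightarrow> 'm) \<Rightarrow> 'm list) set \<Rightarrow> (('m \<Rightarrow> 'm) \<Rightarrow> 'm list) set" where
  "H1_map M A Q act \<pi> \<mu> = (\<Union>\<Phi>\<in>\<mu>. H1_class M A Q act (compose (Aut M A) \<pi> \<Phi>))"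

definition twist :: "'m list monoid \<Rightarrow> (('m \<Rightarrow> 'm) \<Rightarrow> 'm list) \<Rightarrow> ('m \<Rightarrow> 'm) \<Rightarrow> 'm list \<Rightarrow> 'm list" where
  "twist X \<Phi> \<sigma> g = \<Phi> \<sigma> \<otimes>\<^bsub>X\<^esub> map \<sigma> g \<otimes>\<^bsub>X\<^esub> inv\<^bsub>X\<^esub> (\<Phi> \<sigma>)"

text \<open>
  Closure properties of definability, leading to \<open>definable_quotient_exists\<close>: under elimination
  of imaginaries every \<open>A\<close>-definable group \<open>G\<close> with an \<open>A\<close>-definable normal subgroup
  \<open>N\<close> admits an \<open>A\<close>-definable quotient in the sense of \<open>definable_quotient\<close>.
\<close>

lemma tm_val_cong: "(\<And>i. i \<in> tm_vars t \<Longrightarrow> v i = w i) \<Longrightarrow> tm_val M v t = tm_val M w t"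
proof (induction t)
  case (Fun f ts)
  have "map (tm_val M v) ts = map (tm_val M w) ts"
    by (rule map_cong) (use Fun in auto)
  then show ?case by (simp only: tm_val.simps)
qed auto

lemma sat_cong: "(\<And>i. i \<in> fm_free_vars \<phi> \<Longrightarrow> v i = w i) \<Longrightarrow> sat M v \<phi> = sat M w \<phi>"
proof (induction \<phi> arbitrary: v w)
  case (Eq s t)
  then show ?case using tm_val_cong[of s v w M] tm_val_cong[of t v w M] by simp
next
  case (Rel r ts)
  have "map (tm_val M v) ts = map (tm_val M w) ts"
    by (rule map_cong) (use Rel in \<open>auto intro!: tm_val_cong\<close>)
  then show ?case by (simp only: sat.simps)
next
  case (Neg \<phi>)
  have "sat M v \<phi> = sat M w \<phi>"
    by (rule Neg.IH) (use Neg.prems in auto)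
  then show ?case by simp
next
  case (Conj \<phi> \<psi>)
  have "sat M v \<phi> = sat M w \<phi>" "sat M v \<psi> = sat M w \<psi>"
    by (rule Conj.IH; use Conj.prems in auto)+
  then show ?case by simp
next
  case (Ex i \<phi>)
  have "sat M (v(i := c)) \<phi> = sat M (w(i := c)) \<phi>" for c
    by (rule Ex.IH) (use Ex.prems in auto)
  then show ?case by simp
qed

lemma finite_tm_vars: "finite (tm_vars t)"
  by (induction t) auto

lemma finite_fm_free_vars: "finite (fm_free_vars \<phi>)"
  by (induction \<phi>) (auto simp: finite_tm_vars)

lemma finite_tm_consts: "finite (tm_consts t)"
  by (induction t) auto

lemma finite_fm_consts: "finite (fm_consts \<phi>)"
  by (induction \<phi>) (auto simp: finite_tm_consts)

primrec tm_subst :: "(nat \<Rightarrow> nat) \<Rightarrow> ('m \<Rightarrow> ('f, 'm) tm) \<Rightarrow> ('f, 'm) tm \<Rightarrow> ('f, 'm) tm" where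
  "tm_subst r g (Var i) = Var (r i)"
| "tm_subst r g (Const c) = g c"
| "tm_subst r g (Fun f ts) = Fun f (map (tm_subst r g) ts)"

lemma tm_subst:
  "tm_wf M t \<Longrightarrow> (\<And>c. tm_wf M (g c)) \<Longrightarrow> tm_wf M (tm_subst r g t)"
  "tm_consts (tm_subst r g t) \<subseteq> (\<Union>c\<in>tm_consts t. tm_consts (g c))"
  "tm_vars (tm_subst r g t) \<subseteq> r ` tm_vars t \<union> (\<Union>c\<in>tm_consts t. tm_vars (g c))"
  "(\<And>c. c \<in> tm_consts t \<Longrightarrow> tm_val M v (g c) = c) \<Longrightarrow> tm_val M v (tm_subst r g t) = tm_val M (v \<circ> r) t"
proof (induction t)
  case (Fun f ts)
  { case 1 with Fun show ?case by auto }
  { case 2 with Fun show ?case by fastforce }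
  { case 3
    have "tm_vars (tm_subst r g t) \<subseteq> r ` tm_vars (Fun f ts) \<union> (\<Union>c\<in>tm_consts (Fun f ts). tm_vars (g c))"
      if "t \<in> set ts" for t
      by (rule subset_trans[OF Fun(3)[OF that]], intro Un_mono image_mono UN_mono) (use that in auto)
    then show ?case by auto }
  { case 4
    have "tm_val M v (tm_subst r g t) = tm_val M (v \<circ> r) t" if "t \<in> set ts" for t
      by (rule Fun(4)[OF that]) (use 4 that in auto)
    then have "map (tm_val M v \<circ> tm_subst r g) ts = map (tm_val M (v \<circ> r)) ts" by simp
    then show ?case by (simp only: tm_subst.simps tm_val.simps map_map) }
qed auto

definition fm_subst_rel where
  "fm_subst_rel M r g \<phi> \<phi>' \<longleftrightarrow> fm_wf M \<phi>' \<and> fm_consts \<phi>' \<subseteq> (\<Union>c\<in>fm_consts \<phi>. tm_consts (g c)) \<and>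
    fm_free_vars \<phi>' \<subseteq> r ` fm_free_vars \<phi> \<union> (\<Union>c\<in>fm_consts \<phi>. tm_vars (g c)) \<and>
    (\<forall>v. (\<forall>c\<in>fm_consts \<phi>. tm_val M v (g c) = c) \<longrightarrow> sat M v \<phi>' = sat M (v \<circ> r) \<phi>)"

lemma fm_subst_relI:
  assumes "fm_wf M \<phi>'" "fm_consts \<phi>' \<subseteq> (\<Union>c\<in>fm_consts \<phi>. tm_consts (g c))"
    "fm_free_vars \<phi>' \<subseteq> r ` fm_free_vars \<phi> \<union> (\<Union>c\<in>fm_consts \<phi>. tm_vars (g c))"
    "\<And>v. \<forall>c\<in>fm_consts \<phi>. tm_val M v (g c) = c \<Longrightarrow> sat M v \<phi>' = sat M (v \<circ> r) \<phi>"
  shows "fm_subst_rel M r g \<phi> \<phi>'"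
  unfolding fm_subst_rel_def by (intro conjI allI impI assms)

lemma fm_subst_relD:
  assumes "fm_subst_rel M r g \<phi> \<phi>'"
  shows "fm_wf M \<phi>'" "fm_consts \<phi>' \<subseteq> (\<Union>c\<in>fm_consts \<phi>. tm_consts (g c))"
    "fm_free_vars \<phi>' \<subseteq> r ` fm_free_vars \<phi> \<union> (\<Union>c\<in>fm_consts \<phi>. tm_vars (g c))"
    "\<forall>c\<in>fm_consts \<phi>. tm_val M v (g c) = c \<Longrightarrow> sat M v \<phi>' = sat M (v \<circ> r) \<phi>"
  using assms[unfolded fm_subst_rel_def] by - (elim conjE, assumption, elim conjE, assumption, elim conjE, assumption, elim conjE allE impE, assumption, assumption)

lemma fm_subst:
  assumes "fm_wf M \<phi>" and g: "\<And>c. tm_wf M (g c)"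
  shows "\<exists>\<phi>'. fm_subst_rel M r g \<phi> \<phi>'"
  using assms(1)
proof (induction \<phi> arbitrary: r)
  case (Eq s t)
  have "fm_subst_rel M r g (Eq s t) (Eq (tm_subst r g s) (tm_subst r g t))"
  proof (rule fm_subst_relI)
    show "fm_wf M (Eq (tm_subst r g s) (tm_subst r g t))" using Eq g by (simp add: tm_subst(1))
    show "fm_consts (Eq (tm_subst r g s) (tm_subst r g t)) \<subseteq> (\<Union>c\<in>fm_consts (Eq s t). tm_consts (g c))"
      using tm_subst(2)[of r g s] tm_subst(2)[of r g t] by auto
    show "fm_free_vars (Eq (tm_subst r g s) (tm_subst r g t))
        \<subseteq> r ` fm_free_vars (Eq s t) \<union> (\<Union>c\<in>fm_consts (Eq s t). tm_vars (g c))"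
      using tm_subst(3)[of r g s] tm_subst(3)[of r g t] by auto
    fix v assume "\<forall>c\<in>fm_consts (Eq s t). tm_val M v (g c) = c"
    then have "tm_val M v (tm_subst r g s) = tm_val M (v \<circ> r) s" "tm_val M v (tm_subst r g t) = tm_val M (v \<circ> r) t"
      by (auto intro!: tm_subst(4))
    then show "sat M v (Eq (tm_subst r g s) (tm_subst r g t)) = sat M (v \<circ> r) (Eq s t)"
      by (simp only: sat.simps)
  qed
  then show ?case ..
next
  case (Rel p ts)
  have val: "tm_val M v (tm_subst r g t) = tm_val M (v \<circ> r) t"
    if "\<forall>c\<in>fm_consts (Rel p ts). tm_val M v (g c) = c" "t \<in> set ts" for v t
    using that by (intro tm_subst(4)) auto
  have cs: "tm_consts (tm_subst r g t) \<subseteq> (\<Union>c\<in>\<Union>(tm_consts ` set ts). tm_consts (g c))"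
    if "t \<in> set ts" for t
    by (rule subset_trans[OF tm_subst(2)], intro UN_mono) (use that in auto)
  have vs: "tm_vars (tm_subst r g t) \<subseteq>
      r ` (\<Union>t\<in>set ts. tm_vars t) \<union> (\<Union>c\<in>\<Union>(tm_consts ` set ts). tm_vars (g c))"
    if "t \<in> set ts" for t
    by (rule subset_trans[OF tm_subst(3)], intro Un_mono image_mono UN_mono) (use that in auto)
  have "fm_subst_rel M r g (Rel p ts) (Rel p (map (tm_subst r g) ts))"
  proof (rule fm_subst_relI)
    show "fm_wf M (Rel p (map (tm_subst r g) ts))" using Rel g by (auto simp: tm_subst(1))
    show "fm_consts (Rel p (map (tm_subst r g) ts)) \<subseteq> (\<Union>c\<in>fm_consts (Rel p ts). tm_consts (g c))"
      using cs by (simp only: fm.set set_map UN_subset_iff image_image) blast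
    show "fm_free_vars (Rel p (map (tm_subst r g) ts)) \<subseteq>
        r ` fm_free_vars (Rel p ts) \<union> (\<Union>c\<in>fm_consts (Rel p ts). tm_vars (g c))"
      using vs by (simp only: fm_free_vars.simps fm.set set_map UN_subset_iff image_image) blast
    fix v assume v: "\<forall>c\<in>fm_consts (Rel p ts). tm_val M v (g c) = c"
    have "map (tm_val M v \<circ> tm_subst r g) ts = map (tm_val M (v \<circ> r)) ts"
      by (rule map_cong[OF refl]) (simp only: val[OF v] o_apply)
    then show "sat M v (Rel p (map (tm_subst r g) ts)) = sat M (v \<circ> r) (Rel p ts)"
      by (simp only: sat.simps map_map)
  qed
  then show ?case ..
next
  case (Neg \<phi>)
  from Neg.prems have "fm_wf M \<phi>" by simp
  from Neg.IH[OF this, of r] obtain \<phi>' where "fm_subst_rel M r g \<phi> \<phi>'" ..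
  note \<phi>' = fm_subst_relD[OF this]
  have "fm_subst_rel M r g (Neg \<phi>) (Neg \<phi>')"
    by (rule fm_subst_relI) (use \<phi>' in \<open>simp_all only: fm.set fm_wf.simps fm_free_vars.simps sat.simps\<close>)
  then show ?case ..
next
  case (Conj \<phi> \<psi>)
  from Conj.prems have wf: "fm_wf M \<phi>" "fm_wf M \<psi>" by simp_all
  from Conj.IH(1)[OF wf(1), of r] obtain \<phi>' where "fm_subst_rel M r g \<phi> \<phi>'" ..
  note \<phi>' = fm_subst_relD[OF this]
  from Conj.IH(2)[OF wf(2), of r] obtain \<psi>' where "fm_subst_rel M r g \<psi> \<psi>'" ..
  note \<psi>' = fm_subst_relD[OF this]
  have "fm_subst_rel M r g (Conj \<phi> \<psi>) (Conj \<phi>' \<psi>')"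
  proof (rule fm_subst_relI)
    show "fm_wf M (Conj \<phi>' \<psi>')" using \<phi>'(1) \<psi>'(1) by simp
    show "fm_consts (Conj \<phi>' \<psi>') \<subseteq> (\<Union>c\<in>fm_consts (Conj \<phi> \<psi>). tm_consts (g c))"
      using \<phi>'(2) \<psi>'(2) by auto
    show "fm_free_vars (Conj \<phi>' \<psi>') \<subseteq> r ` fm_free_vars (Conj \<phi> \<psi>) \<union> (\<Union>c\<in>fm_consts (Conj \<phi> \<psi>). tm_vars (g c))"
      using \<phi>'(3) \<psi>'(3) by auto
    fix v assume "\<forall>c\<in>fm_consts (Conj \<phi> \<psi>). tm_val M v (g c) = c"
    then have "\<forall>c\<in>fm_consts \<phi>. tm_val M v (g c) = c" "\<forall>c\<in>fm_consts \<psi>. tm_val M v (g c) = c"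
      by simp_all
    from \<phi>'(4)[OF this(1)] \<psi>'(4)[OF this(2)]
    show "sat M v (Conj \<phi>' \<psi>') = sat M (v \<circ> r) (Conj \<phi> \<psi>)"
      by (simp only: sat.simps)
  qed
  then show ?case ..
next
  case (Ex i \<phi>)
  let ?B = "r ` fm_free_vars \<phi> \<union> (\<Union>c\<in>fm_consts \<phi>. tm_vars (g c))"
  have "finite ?B" by (simp add: finite_fm_free_vars finite_fm_consts finite_tm_vars)
  then obtain y where y: "y \<notin> ?B" using ex_new_if_finite infinite_UNIV_nat by blast
  from Ex.prems have "fm_wf M \<phi>" by simp
  from Ex.IH[OF this, of "r(i := y)"] obtain \<phi>' where "fm_subst_rel M (r(i := y)) g \<phi> \<phi>'" ..
  note \<phi>' = fm_subst_relD[OF this]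
  have "fm_subst_rel M r g (Ex i \<phi>) (Ex y \<phi>')"
  proof (rule fm_subst_relI)
    show "fm_wf M (Ex y \<phi>')" using \<phi>'(1) by simp
    show "fm_consts (Ex y \<phi>') \<subseteq> (\<Union>c\<in>fm_consts (Ex i \<phi>). tm_consts (g c))"
      using \<phi>'(2) by simp
    show "fm_free_vars (Ex y \<phi>') \<subseteq> r ` fm_free_vars (Ex i \<phi>) \<union> (\<Union>c\<in>fm_consts (Ex i \<phi>). tm_vars (g c))"
    proof
      fix j assume "j \<in> fm_free_vars (Ex y \<phi>')"
      then have j: "j \<in> fm_free_vars \<phi>'" "j \<noteq> y" by simp_all
      with \<phi>'(3) consider k where "k \<in> fm_free_vars \<phi>" "j = (r(i := y)) k"
        | "j \<in> (\<Union>c\<in>fm_consts \<phi>. tm_vars (g c))" by blast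
      then show "j \<in> r ` fm_free_vars (Ex i \<phi>) \<union> (\<Union>c\<in>fm_consts (Ex i \<phi>). tm_vars (g c))"
        by cases (use j in \<open>auto split: if_splits\<close>)
    qed
    fix v assume v: "\<forall>c\<in>fm_consts (Ex i \<phi>). tm_val M v (g c) = c"
    have "sat M (v(y := a)) \<phi>' = sat M ((v \<circ> r)(i := a)) \<phi>" for a
    proof -
      have "tm_val M (v(y := a)) (g c) = c" if "c \<in> fm_consts \<phi>" for c
      proof -
        have "tm_val M (v(y := a)) (g c) = tm_val M v (g c)"
          by (rule tm_val_cong) (use that y in auto)
        then show ?thesis using v that by simp
      qed
      then have "sat M (v(y := a)) \<phi>' = sat M (v(y := a) \<circ> r(i := y)) \<phi>" by (intro \<phi>'(4) ballI)
      also have "\<dots> = sat M ((v \<circ> r)(i := a)) \<phi>" by (rule sat_cong) (use y in auto)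
      finally show ?thesis .
    qed
    then show "sat M v (Ex y \<phi>') = sat M (v \<circ> r) (Ex i \<phi>)" by (simp only: sat.simps)
  qed
  then show ?case ..
qed

text \<open>The predicate \<open>P\<close> on \<open>n\<close>-tuples is \<open>A\<close>-definable.\<close>

definition definable_pred where
  "definable_pred M A n P \<longleftrightarrow> definable_set M A n {a \<in> tuples n. P a}"

lemma definable_predI:
  assumes "fm_wf M \<phi>" "fm_consts \<phi> \<subseteq> A" "fm_free_vars \<phi> \<subseteq> {..<n}"
    "\<And>a. length a = n \<Longrightarrow> P a \<longleftrightarrow> sat M (\<lambda>i. a ! i) \<phi>"
  shows "definable_pred M A n P"
proof -
  have "{a \<in> tuples n. P a} = {a \<in> tuples n. holds M \<phi> a}"
    using assms(4) by (auto simp: tuples_def holds_def)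
  moreover have "\<phi> \<in> formulas M A n" using assms(1-3) by (simp add: formulas_def)
  ultimately show ?thesis unfolding definable_pred_def definable_set_def by (rule bexI)
qed

lemma definable_predE:
  assumes "definable_pred M A n P"
  obtains \<phi> where "fm_wf M \<phi>" "fm_consts \<phi> \<subseteq> A" "fm_free_vars \<phi> \<subseteq> {..<n}"
    "\<And>a. length a = n \<Longrightarrow> P a \<longleftrightarrow> sat M (\<lambda>i. a ! i) \<phi>"
proof -
  from assms obtain \<phi> where \<phi>: "\<phi> \<in> formulas M A n" "{a \<in> tuples n. P a} = {a \<in> tuples n. holds M \<phi> a}"
    unfolding definable_pred_def definable_set_def by (rule bexE)
  have "P a \<longleftrightarrow> sat M (\<lambda>i. a ! i) \<phi>" if "length a = n" for a
    using eq_refl[OF \<phi>(2)] eq_refl[OF \<phi>(2)[symmetric]] that by (auto simp: tuples_def holds_def)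
  with \<phi>(1) show thesis by (intro that[of \<phi>]) (simp_all add: formulas_def)
qed

lemma definable_set_iff_pred:
  "definable_set M A n X \<longleftrightarrow> X \<subseteq> tuples n \<and> definable_pred M A n (\<lambda>a. a \<in> X)"
proof
  assume "definable_set M A n X"
  moreover from this have "X \<subseteq> tuples n" by (auto simp: definable_set_def)
  moreover from this have "{a \<in> tuples n. a \<in> X} = X" by blast
  ultimately show "X \<subseteq> tuples n \<and> definable_pred M A n (\<lambda>a. a \<in> X)"
    by (simp add: definable_pred_def)
next
  assume *: "X \<subseteq> tuples n \<and> definable_pred M A n (\<lambda>a. a \<in> X)"
  then have "{a \<in> tuples n. a \<in> X} = X" by blast
  with * show "definable_set M A n X" by (simp add: definable_pred_def)
qed

lemma dp_cong:
  assumes "definable_pred M A n P" "\<And>a. length a = n \<Longrightarrow> Q a = P a"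
  shows "definable_pred M A n Q"
  using assms(1) by (rule definable_predE) (rule definable_predI, assumption+, simp add: assms(2))

lemma dp_mono:
  assumes "definable_pred M A n P" "A \<subseteq> B"
  shows "definable_pred M B n P"
  using assms(1)
  by (rule definable_predE) (rule definable_predI, assumption, erule subset_trans[OF _ assms(2)], assumption, simp)

lemma dp_not:
  assumes "definable_pred M A n P"
  shows "definable_pred M A n (\<lambda>a. \<not> P a)"
  using assms by (rule definable_predE) (rule definable_predI[of _ "Neg _"], simp_all)

lemma dp_and:
  assumes "definable_pred M A n P" "definable_pred M A n Q"
  shows "definable_pred M A n (\<lambda>a. P a \<and> Q a)"
  by (rule definable_predE[OF assms(1)], rule definable_predE[OF assms(2)], rule definable_predI[of _ "Conj _ _"])
     simp_all

lemma dp_or: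
  assumes "definable_pred M A n P" "definable_pred M A n Q"
  shows "definable_pred M A n (\<lambda>a. P a \<or> Q a)"
  using dp_not[OF dp_and[OF dp_not[OF assms(1)] dp_not[OF assms(2)]]] by simp

lemma dp_imp:
  assumes "definable_pred M A n P" "definable_pred M A n Q"
  shows "definable_pred M A n (\<lambda>a. P a \<longrightarrow> Q a)"
  using dp_or[OF dp_not[OF assms(1)] assms(2)] by simp

lemma dp_True: "definable_pred M A n (\<lambda>a. True)"
  by (rule definable_predI[of _ "Ex 0 (Eq (Var 0) (Var 0))"]) simp_all

lemma dp_eq_nth: "i < n \<Longrightarrow> j < n \<Longrightarrow> definable_pred M A n (\<lambda>a. a ! i = a ! j)"
  by (rule definable_predI[of _ "Eq (Var i) (Var j)"]) simp_all

lemma dp_eq_const: "i < n \<Longrightarrow> c \<in> A \<Longrightarrow> definable_pred M A n (\<lambda>a. a ! i = c)"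
  by (rule definable_predI[of _ "Eq (Var i) (Const c)"]) simp_all

lemma dp_eq_map: "length is = length js \<Longrightarrow> set is \<subseteq> {..<n} \<Longrightarrow> set js \<subseteq> {..<n} \<Longrightarrow>
    definable_pred M A n (\<lambda>a. map ((!) a) is = map ((!) a) js)"
proof (induction "is" js rule: list_induct2)
  case Nil then show ?case by (simp add: dp_True)
next
  case (Cons i "is" j js)
  then show ?case by (auto intro!: dp_and dp_eq_nth)
qed

lemma dp_eq_map_const: "length is = length c \<Longrightarrow> set is \<subseteq> {..<n} \<Longrightarrow> set c \<subseteq> A \<Longrightarrow>
    definable_pred M A n (\<lambda>a. map ((!) a) is = c)"
proof (induction "is" c rule: list_induct2)
  case Nil then show ?case by (simp add: dp_True)
next
  case (Cons i "is" d c)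
  then show ?case by (auto intro!: dp_and dp_eq_const)
qed

lemma dp_ex1:
  assumes "definable_pred M A (Suc n) P"
  shows "definable_pred M A n (\<lambda>a. \<exists>c. P (a @ [c]))"
  using assms
proof (rule definable_predE)
  fix \<phi> assume \<phi>: "fm_wf M \<phi>" "fm_consts \<phi> \<subseteq> A" "fm_free_vars \<phi> \<subseteq> {..<Suc n}"
    "\<And>a. length a = Suc n \<Longrightarrow> P a = sat M ((!) a) \<phi>"
  show ?thesis
  proof (rule definable_predI[of _ "Ex n \<phi>"])
    fix a :: "'c list" assume a: "length a = n"
    have "P (a @ [c]) = sat M (((!) a)(n := c)) \<phi>" for c
    proof -
      have "P (a @ [c]) = sat M ((!) (a @ [c])) \<phi>" using a by (intro \<phi>(4)) simp
      also have "\<dots> = sat M (((!) a)(n := c)) \<phi>"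
        by (rule sat_cong) (use subsetD[OF \<phi>(3)] a in \<open>auto simp: nth_append less_Suc_eq\<close>)
      finally show ?thesis .
    qed
    then show "(\<exists>c. P (a @ [c])) = sat M ((!) a) (Ex n \<phi>)" by simp
  qed (use \<phi>(1-3) in \<open>auto simp: less_Suc_eq\<close>)
qed

lemma dp_ex: "definable_pred M A (n + k) P \<Longrightarrow> definable_pred M A n (\<lambda>a. \<exists>b\<in>tuples k. P (a @ b))"
proof (induction k arbitrary: P)
  case 0
  then show ?case by (simp add: tuples_def)
next
  case (Suc k)
  have "definable_pred M A (n + k) (\<lambda>a. \<exists>c. P (a @ [c]))"
    using Suc.prems by (intro dp_ex1) simp
  from Suc.IH[OF this] show ?case
  proof (rule dp_cong)
    fix a
    show "(\<exists>b\<in>tuples (Suc k). P (a @ b)) \<longleftrightarrow> (\<exists>b\<in>tuples k. \<exists>c. P ((a @ b) @ [c]))"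
    proof
      assume "\<exists>b\<in>tuples (Suc k). P (a @ b)"
      then obtain b where "length b = Suc k" "P (a @ b)" by (auto simp: tuples_def)
      then show "\<exists>b\<in>tuples k. \<exists>c. P ((a @ b) @ [c])"
        by (intro bexI[of _ "butlast b"] exI[of _ "last b"]) 
          (auto simp: tuples_def append_butlast_last_id length_greater_0_conv[symmetric] simp del: length_greater_0_conv)
    next
      assume "\<exists>b\<in>tuples k. \<exists>c. P ((a @ b) @ [c])"
      then obtain b c where "length b = k" "P ((a @ b) @ [c])" by (auto simp: tuples_def)
      then show "\<exists>b\<in>tuples (Suc k). P (a @ b)"
        by (intro bexI[of _ "b @ [c]"]) (auto simp: tuples_def)
    qed
  qed
qed

lemma dp_all:
  assumes "definable_pred M A (n + k) P"
  shows "definable_pred M A n (\<lambda>a. \<forall>b\<in>tuples k. P (a @ b))"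
  using dp_not[OF dp_ex[OF dp_not[OF assms]]] by simp

lemma dp_reindex:
  assumes "definable_pred M A m P" "length is = m" "set is \<subseteq> {..<n}"
  shows "definable_pred M A n (\<lambda>a. P (map ((!) a) is))"
proof -
  from assms(1) obtain \<phi> where \<phi>: "fm_wf M \<phi>" "fm_consts \<phi> \<subseteq> A" "fm_free_vars \<phi> \<subseteq> {..<m}"
    "\<And>a. length a = m \<Longrightarrow> P a = sat M ((!) a) \<phi>" by (rule definable_predE) (rule that, assumption, assumption, assumption, simp)
  from fm_subst[OF \<phi>(1), where g = Const and r = "\<lambda>i. is ! i"] obtain \<phi>' where
    "fm_subst_rel M (\<lambda>i. is ! i) Const \<phi> \<phi>'" by auto
  note rel = fm_subst_relD[OF this]
  have \<phi>': "fm_wf M \<phi>'" "fm_consts \<phi>' \<subseteq> fm_consts \<phi>" "fm_free_vars \<phi>' \<subseteq> (\<lambda>i. is ! i) ` fm_free_vars \<phi>"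
    "sat M v \<phi>' = sat M (v \<circ> (\<lambda>i. is ! i)) \<phi>" for v
    using rel(1-3) rel(4)[of v] by simp_all
  have "P (map ((!) a) is) = sat M ((!) a) \<phi>'" for a
  proof -
    have "P (map ((!) a) is) = sat M ((!) (map ((!) a) is)) \<phi>" using assms(2) by (intro \<phi>(4)) simp
    also have "\<dots> = sat M ((!) a \<circ> (\<lambda>i. is ! i)) \<phi>"
      by (rule sat_cong) (use \<phi>(3) assms(2) in auto)
    finally show ?thesis by (simp only: \<phi>'(4))
  qed
  moreover have "fm_free_vars \<phi>' \<subseteq> {..<n}"
  proof
    fix j assume "j \<in> fm_free_vars \<phi>'"
    then obtain i where "j = is ! i" "i < length is" using \<phi>'(3) \<phi>(3) assms(2) by auto
    moreover from this have "is ! i \<in> {..<n}" using assms(3) by (intro subsetD[OF assms(3)] nth_mem)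
    ultimately show "j \<in> {..<n}" by simp
  qed
  moreover have "fm_consts \<phi>' \<subseteq> A" using \<phi>'(2) \<phi>(2) by (rule subset_trans)
  ultimately show ?thesis using \<phi>'(1) by (intro definable_predI[of _ \<phi>'])
qed

lemma dp_params:
  fixes P :: "'m list \<Rightarrow> bool"
  assumes "definable_pred M A n P"
  obtains c P' where "set c \<subseteq> A" "definable_pred M {} (n + length c) P'"
    "\<And>a. length a = n \<Longrightarrow> P a \<longleftrightarrow> P' (a @ c)"
proof -
  from assms(1) obtain \<phi> where \<phi>: "fm_wf M \<phi>" "fm_consts \<phi> \<subseteq> A" "fm_free_vars \<phi> \<subseteq> {..<n}"
    "\<And>a. length a = n \<Longrightarrow> P a = sat M ((!) a) \<phi>" by (rule definable_predE) (rule that, assumption, assumption, assumption, simp)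
  obtain c where c: "set c = fm_consts \<phi>" using finite_list[OF finite_fm_consts[of \<phi>]] ..
  define ix where "ix d = (SOME i. i < length c \<and> c ! i = d)" for d
  have ix: "ix d < length c" "c ! ix d = d" if "d \<in> set c" for d
    using someI_ex[of "\<lambda>i. i < length c \<and> c ! i = d"] that by (auto simp: in_set_conv_nth ix_def)
  from fm_subst[OF \<phi>(1), where g = "\<lambda>d. Var (n + ix d)" and r = id] obtain \<phi>' where
    "fm_subst_rel M id (\<lambda>d. Var (n + ix d)) \<phi> \<phi>'" by auto
  note rel = fm_subst_relD[OF this]
  have \<phi>': "fm_wf M \<phi>'" "fm_consts \<phi>' \<subseteq> {}" "fm_free_vars \<phi>' \<subseteq> fm_free_vars \<phi> \<union> (\<Union>d\<in>fm_consts \<phi>. {n + ix d})"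
    "(\<forall>d\<in>fm_consts \<phi>. v (n + ix d) = d) \<Longrightarrow> sat M v \<phi>' = sat M v \<phi>" for v
    using rel(1-3) rel(4)[of v] by simp_all
  show thesis
  proof
    show "set c \<subseteq> A" using c \<phi>(2) by simp
    have "fm_free_vars \<phi>' \<subseteq> {..<n + length c}" 
    proof
      fix j assume "j \<in> fm_free_vars \<phi>'"
      with \<phi>'(3) consider "j \<in> fm_free_vars \<phi>" | d where "d \<in> fm_consts \<phi>" "j = n + ix d" by blast
      then show "j \<in> {..<n + length c}"
      proof cases
        case 1
        with \<phi>(3) have "j \<in> {..<n}" by (rule subsetD)
        then show ?thesis by simp
      next
        case (2 d)
        then show ?thesis using ix(1)[of d] c by simp
      qed
    qed
    then show "definable_pred M {} (n + length c) (\<lambda>a. sat M ((!) a) \<phi>')"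
      using \<phi>'(1,2) by (intro definable_predI[of _ \<phi>'] refl) simp_all
    fix a :: "'m list" assume a: "length a = n"
    have "P a = sat M ((!) a) \<phi>" using a by (rule \<phi>(4))
    also have "\<dots> = sat M ((!) (a @ c)) \<phi>" 
    proof (rule sat_cong)
      fix i assume "i \<in> fm_free_vars \<phi>"
      with \<phi>(3) have "i \<in> {..<n}" by (rule subsetD)
      then show "a ! i = (a @ c) ! i" using a by (simp add: nth_append)
    qed
    also have "\<dots> = sat M ((!) (a @ c)) \<phi>'" 
    proof (rule \<phi>'(4)[symmetric], rule ballI)
      fix d assume "d \<in> fm_consts \<phi>"
      then show "(a @ c) ! (n + ix d) = d" using ix(2)[of d] c a by (simp add: nth_append)
    qed
    finally show "P a = sat M ((!) (a @ c)) \<phi>'" .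
  qed
qed


text \<open>The slice of \<open>k\<close> entries starting at position \<open>i\<close>.\<close>

definition slice :: "nat \<Rightarrow> nat \<Rightarrow> 'm list \<Rightarrow> 'm list" where
  "slice i k a = map ((!) a) [i..<i + k]"

lemma length_slice [simp]: "length (slice i k a) = k"
  by (simp add: slice_def)

lemma slice_append1: "i + k \<le> length a \<Longrightarrow> slice i k (a @ b) = slice i k a"
  by (auto simp: slice_def nth_append)

lemma slice_append2: "length a \<le> i \<Longrightarrow> slice i k (a @ b) = slice (i - length a) k b"
  by (rule nth_equalityI) (auto simp: slice_def nth_append)

lemma slice_all: "k = length a \<Longrightarrow> slice 0 k a = a"
  by (simp add: slice_def map_nth)

lemmas slice_simps = slice_append1 slice_append2 slice_all

lemma slice_split: "length a = k + l \<Longrightarrow> a = slice 0 k a @ slice k l a"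
  by (rule nth_equalityI) (auto simp: slice_def nth_append)

lemma slice_slice: "j + l \<le> k \<Longrightarrow> slice j l (slice i k a) = slice (i + j) l a"
  by (rule nth_equalityI) (auto simp: slice_def ac_simps)

lemma dp_slice:
  assumes "definable_pred M A m P" "i + m \<le> n"
  shows "definable_pred M A n (\<lambda>a. P (slice i m a))"
  unfolding slice_def by (rule dp_reindex) (use assms in auto)

lemma dp_slice2:
  assumes "definable_pred M A (m + m') P" "i + m \<le> n" "i' + m' \<le> n"
  shows "definable_pred M A n (\<lambda>a. P (slice i m a @ slice i' m' a))"
  unfolding slice_def map_append[symmetric] by (rule dp_reindex) (use assms in auto)

lemma dp_slice3:
  assumes "definable_pred M A (m + m' + m'') P" "i + m \<le> n" "i' + m' \<le> n" "i'' + m'' \<le> n"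
  shows "definable_pred M A n (\<lambda>a. P (slice i m a @ slice i' m' a @ slice i'' m'' a))"
  unfolding slice_def map_append[symmetric] by (rule dp_reindex) (use assms in \<open>auto simp: add.assoc\<close>)

lemma dp_slice_eq: "i + k \<le> n \<Longrightarrow> j + k \<le> n \<Longrightarrow> definable_pred M A n (\<lambda>a. slice i k a = slice j k a)"
  unfolding slice_def by (rule dp_eq_map) auto

lemma dp_slice_const: "i + length c \<le> n \<Longrightarrow> set c \<subseteq> A \<Longrightarrow> definable_pred M A n (\<lambda>a. slice i (length c) a = c)"
  unfolding slice_def by (rule dp_eq_map_const) auto

lemma definable_kernel:
  assumes ei: "eliminates_imaginaries M" and D: "definable_set M A n D" and E: "equiv D E"
    and E_def: "definable_set M A (n + n) {x @ y |x y. (x, y) \<in> E}"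
  shows "\<exists>k f. definable_fun M A n k D f \<and> (\<forall>x\<in>D. \<forall>y\<in>D. (x, y) \<in> E \<longleftrightarrow> f x = f y)"
proof -
  have D_sub: "D \<subseteq> tuples n" and dD: "definable_pred M A n (\<lambda>a. a \<in> D)"
    using D by (auto simp: definable_set_iff_pred)
  let ?E = "{x @ y |x y. (x, y) \<in> E}"
  have "definable_pred M A (n + n) (\<lambda>a. a \<in> ?E)" using E_def by (simp add: definable_set_iff_pred)
  then obtain c Y where c: "set c \<subseteq> A" and Y: "definable_pred M {} (n + n + length c) Y"
    and EY: "\<And>a. length a = n + n \<Longrightarrow> a \<in> ?E \<longleftrightarrow> Y (a @ c)"
    by (rule dp_params) (rule that, assumption, assumption, simp)
  define l p where "l = length c" and "p = n + length c"
  have EY': "(x, y) \<in> E \<longleftrightarrow> Y (x @ y @ c)" if len: "length x = n" "length y = n" for x y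
  proof -
    have "x @ y \<in> ?E \<longleftrightarrow> (x, y) \<in> E"
    proof
      assume "x @ y \<in> ?E"
      then obtain x' y' where xy: "x @ y = x' @ y'" "(x', y') \<in> E" by blast
      then have "length x' = n" using E D_sub by (auto simp: equiv_def tuples_def)
      then have "x = x'" "y = y'" using xy(1) len by simp_all
      then show "(x, y) \<in> E" using xy(2) by simp
    qed blast
    then show ?thesis using EY[of "x @ y"] len by simp
  qed
  define good where "good u \<longleftrightarrow>
    (\<forall>t\<in>tuples (n + n). Y (slice 0 n t @ slice n n t @ u) \<longrightarrow> Y (slice n n t @ slice 0 n t @ u)) \<and>
    (\<forall>t\<in>tuples (n + n + n). Y (slice 0 n t @ slice n n t @ u) \<and> Y (slice n n t @ slice (n + n) n t @ u)
        \<longrightarrow> Y (slice 0 n t @ slice (n + n) n t @ u))" for u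
  have good1: "Y (y @ x @ u)" if "good u" "Y (x @ y @ u)" and len: "length x = n" "length y = n" for u x y
  proof -
    have "x @ y \<in> tuples (n + n)" using len by (simp add: tuples_def)
    moreover have "slice 0 n (x @ y) = x" "slice n n (x @ y) = y" using len by (simp_all add: slice_simps)
    ultimately show ?thesis using that(1,2) unfolding good_def by metis
  qed
  have good2: "Y (x @ z @ u)" if "good u" "Y (x @ y @ u)" "Y (y @ z @ u)"
    and len: "length x = n" "length y = n" "length z = n" for u x y z
  proof -
    have "x @ y @ z \<in> tuples (n + n + n)" using len by (simp add: tuples_def)
    moreover have "slice 0 n (x @ y @ z) = x" "slice n n (x @ y @ z) = y" "slice (n + n) n (x @ y @ z) = z"
      using len by (simp_all add: slice_simps)
    ultimately show ?thesis using that(1-3) unfolding good_def by metis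
  qed
  have "good c"
  proof -
    have "sym E" "trans E" using E by (simp_all add: equiv_def)
    then have 1: "Y (x @ y @ c) \<Longrightarrow> Y (y @ x @ c)" if "length x = n" "length y = n" for x y
      using EY'[OF that] EY'[OF that(2,1)] by (simp add: sym_def)
    have 2: "Y (x @ y @ c) \<and> Y (y @ z @ c) \<Longrightarrow> Y (x @ z @ c)"
      if "length x = n" "length y = n" "length z = n" for x y z
      using EY'[OF that(1,2)] EY'[OF that(2,3)] EY'[OF that(1,3)] \<open>trans E\<close> unfolding trans_def by blast
    show ?thesis unfolding good_def
      by (intro conjI ballI impI) (erule 1[OF length_slice length_slice], erule 2[OF length_slice length_slice length_slice])
  qed
  have Y': "definable_pred M {} N (\<lambda>a. Y (slice i n a @ slice j n a @ slice m l a))"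
    if "i + n \<le> N" "j + n \<le> N" "m + l \<le> N" for N i j m
    using dp_slice3[OF Y[folded l_def] that] .
  have dgood: "definable_pred M {} l good"
  proof -
    have 1: "definable_pred M {} (l + (n + n)) (\<lambda>a.
        Y (slice l n a @ slice (l + n) n a @ slice 0 l a) \<longrightarrow> Y (slice (l + n) n a @ slice l n a @ slice 0 l a))"
      by (intro dp_imp Y') simp_all
    have 2: "definable_pred M {} (l + (n + n + n)) (\<lambda>a.
        Y (slice l n a @ slice (l + n) n a @ slice 0 l a) \<and> Y (slice (l + n) n a @ slice (l + n + n) n a @ slice 0 l a)
         \<longrightarrow> Y (slice l n a @ slice (l + n + n) n a @ slice 0 l a))"
      by (intro dp_imp dp_and Y') simp_all
    show ?thesis
      by (rule dp_cong[OF dp_and[OF dp_all[OF 1] dp_all[OF 2]]])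
        (simp add: good_def slice_simps tuples_def)
  qed
  define R where "R a b \<longleftrightarrow> slice n l a = slice n l b \<and>
      (slice 0 n a = slice 0 n b \<or> good (slice n l a) \<and> Y (slice 0 n a @ slice 0 n b @ slice n l a))" for a b
  define E' where "E' = {(a, b). a \<in> tuples p \<and> b \<in> tuples p \<and> R a b}"
  have "equiv (tuples p) E'"
  proof (rule equivI)
    show "E' \<subseteq> tuples p \<times> tuples p" "refl_on (tuples p) E'"
      by (auto simp: E'_def refl_on_def R_def)
    have "R y x" if "R x y" for x y
      using that good1[of "slice n l x" "slice 0 n x" "slice 0 n y"] unfolding R_def by auto
    then show "sym E'" unfolding sym_def E'_def by blast
    have "R x z" if "R x y" "R y z" for x y z
      using that good2[of "slice n l x" "slice 0 n x" "slice 0 n y" "slice 0 n z"] unfolding R_def by auto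
    then show "trans E'" unfolding trans_def E'_def by blast
  qed
  moreover have "definable_set M {} (p + p) {x @ y |x y. (x, y) \<in> E'}"
  proof -
    have "definable_pred M {} (p + p) (\<lambda>a. slice n l a = slice (p + n) l a \<and>
      (slice 0 n a = slice p n a \<or> good (slice n l a) \<and> Y (slice 0 n a @ slice p n a @ slice n l a)))"
      by (intro dp_and dp_or Y' dp_slice[OF dgood] dp_slice_eq) (simp_all add: p_def l_def)
    moreover have "{x @ y |x y. (x, y) \<in> E'} = {a \<in> tuples (p + p). slice n l a = slice (p + n) l a \<and>
      (slice 0 n a = slice p n a \<or> good (slice n l a) \<and> Y (slice 0 n a @ slice p n a @ slice n l a))}"
      (is "?L = ?R")
    proof -
      have "a \<in> ?R \<longleftrightarrow> (\<exists>x y. a = x @ y \<and> (x, y) \<in> E')" for a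
      proof
        assume a: "a \<in> ?R"
        let ?x = "slice 0 p a" and ?y = "slice p p a"
        have "a = ?x @ ?y" using a by (intro slice_split) (auto simp: tuples_def)
        moreover have "(?x, ?y) \<in> E'"
          using a unfolding E'_def R_def by (auto simp: tuples_def slice_slice p_def l_def)
        ultimately show "\<exists>x y. a = x @ y \<and> (x, y) \<in> E'" by blast
      next
        assume "\<exists>x y. a = x @ y \<and> (x, y) \<in> E'"
        then show "a \<in> ?R" unfolding E'_def R_def
          by (auto simp: tuples_def slice_simps p_def l_def)
      qed
      then show ?thesis by blast
    qed
    ultimately show ?thesis by (simp add: definable_pred_def)
  qed
  ultimately obtain k f where f: "definable_fun M {} p k (tuples p) f"
    "\<forall>x\<in>tuples p. \<forall>y\<in>tuples p. (x, y) \<in> E' \<longleftrightarrow> f x = f y"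
    using ei unfolding eliminates_imaginaries_def by meson
  define g where "g x = f (x @ c)" for x
  have p: "x @ c \<in> tuples p" if "x \<in> D" for x using that D_sub by (auto simp: tuples_def p_def)
  have gk: "g ` D \<subseteq> tuples k" using f(1) p unfolding definable_fun_def g_def by auto
  have "definable_set M A (n + k) {x @ g x |x. x \<in> D}"
  proof -
    let ?F = "{x @ f x |x. x \<in> tuples p}"
    have F: "definable_pred M A (n + l + k) (\<lambda>a. a \<in> ?F)"
      using f(1) dp_mono[of M "{}" "p + k" _ A] unfolding definable_fun_def definable_set_iff_pred p_def l_def by auto
    have "definable_pred M A (n + k) (\<lambda>a. slice 0 n a \<in> D \<and>
       (\<exists>u\<in>tuples l. slice (n + k) l (a @ u) = c \<and> slice 0 n (a @ u) @ slice (n + k) l (a @ u) @ slice n k (a @ u) \<in> ?F))"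
      
      by (intro dp_and dp_ex[where P = "\<lambda>b. slice (n + k) l b = c \<and> slice 0 n b @ slice (n + k) l b @ slice n k b \<in> ?F"]
            dp_slice3[OF F] dp_slice[OF dD] dp_slice_const[of _ c, folded l_def] c) simp_all
    moreover have "{x @ g x |x. x \<in> D} = {a \<in> tuples (n + k). slice 0 n a \<in> D \<and>
       (\<exists>u\<in>tuples l. slice (n + k) l (a @ u) = c \<and> slice 0 n (a @ u) @ slice (n + k) l (a @ u) @ slice n k (a @ u) \<in> ?F)}"
       (is "?L = ?R")
    proof -
      have "a \<in> ?R \<longleftrightarrow> (\<exists>x. a = x @ g x \<and> x \<in> D)" for a
      proof
        assume a: "a \<in> ?R"
        then have len: "length a = n + k" by (simp add: tuples_def)
        let ?x = "slice 0 n a" and ?y = "slice n k a"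
        have "?x @ c @ ?y \<in> ?F" using a len by (auto simp: tuples_def slice_simps)
        then obtain z where z: "?x @ c @ ?y = z @ f z" "length z = p" by (auto simp: tuples_def)
        then have "z = ?x @ c" "?y = f z"
          using append_eq_append_conv[of "?x @ c" z ?y "f z"] by (auto simp: p_def)
        then have "?y = g ?x" by (simp add: g_def)
        moreover have "a = ?x @ ?y" using len by (rule slice_split)
        ultimately show "\<exists>x. a = x @ g x \<and> x \<in> D" using a by auto
      next
        assume "\<exists>x. a = x @ g x \<and> x \<in> D"
        then obtain x where x: "a = x @ g x" "x \<in> D" by blast
        then have len: "length x = n" "length (g x) = k" using D_sub gk by (auto simp: tuples_def)
        have "x @ c @ g x \<in> ?F" 
          using p[OF x(2)] by (intro CollectI exI[of _ "x @ c"]) (simp add: g_def)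
        then have "\<exists>u\<in>tuples l. slice (n + k) l (a @ u) = c \<and>
            slice 0 n (a @ u) @ slice (n + k) l (a @ u) @ slice n k (a @ u) \<in> ?F"
          using len by (intro bexI[of _ c]) (simp_all add: x(1) l_def tuples_def slice_simps)
        moreover have "a \<in> tuples (n + k)" "slice 0 n a \<in> D" using x len by (simp_all add: tuples_def slice_simps)
        ultimately show "a \<in> ?R" by (intro CollectI conjI)
      qed
      then show ?thesis by blast
    qed
    ultimately show ?thesis by (simp add: definable_pred_def)
  qed
  then have "definable_fun M A n k D g" using gk D_sub by (simp add: definable_fun_def)
  moreover have "(x, y) \<in> E \<longleftrightarrow> g x = g y" if "x \<in> D" "y \<in> D" for x y
  proof -
    have len: "length x = n" "length y = n" using that D_sub by (auto simp: tuples_def)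
    have "g x = g y \<longleftrightarrow> (x @ c, y @ c) \<in> E'" using f(2) p that by (simp add: g_def)
    also have "\<dots> \<longleftrightarrow> x = y \<or> (x, y) \<in> E"
      using len \<open>good c\<close> EY'[OF len] by (auto simp: E'_def R_def tuples_def p_def l_def slice_simps)
    also have "\<dots> \<longleftrightarrow> (x, y) \<in> E" using E that by (auto simp: equiv_def refl_on_def)
    finally show ?thesis by simp
  qed
  ultimately show ?thesis by blast
qed

lemma definable_quotient_exists:
  assumes ei: "eliminates_imaginaries M" and "definable_group M A G" and N: "definable_normal_subgroup M A G N"
  shows "\<exists>Q \<pi>. definable_quotient M A G N Q \<pi>"
proof -
  let ?mult = "{x @ y @ (x \<otimes>\<^bsub>G\<^esub> y) |x y. x \<in> carrier G \<and> y \<in> carrier G}"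
  from assms(2) obtain n where G: "group G" and dG: "definable_set M A n (carrier G)"
    and dm: "definable_set M A (n + n + n) ?mult"
    unfolding definable_group_def by blast
  interpret group G by (rule G)
  from N obtain n' where NG: "N \<lhd> G" and dN': "definable_set M A n' N"
    unfolding definable_normal_subgroup_def by blast
  interpret N: normal N G by (rule NG)
  have G_len: "length x = n" if "x \<in> carrier G" for x
    using dG that by (auto simp: definable_set_iff_pred tuples_def)
  have "n' = n"
  proof -
    have "\<one>\<^bsub>G\<^esub> \<in> tuples n'"
      using dN' N.one_closed unfolding definable_set_iff_pred by (blast intro: subsetD)
    then show ?thesis using G_len[OF one_closed] by (simp add: tuples_def)
  qed
  then have dN: "definable_pred M A n (\<lambda>a. a \<in> N)" using dN' by (simp add: definable_set_iff_pred)
  define mul where "mul = ?mult"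
  have dm: "definable_pred M A (n + n + n) (\<lambda>a. a \<in> mul)"
    using dm by (simp add: definable_set_iff_pred mul_def)
  have mult_iff: "x @ y @ z \<in> mul \<longleftrightarrow> x \<in> carrier G \<and> y \<in> carrier G \<and> z = x \<otimes>\<^bsub>G\<^esub> y"
    if "length x = n" "length y = n" for x y z
  proof
    assume "x @ y @ z \<in> mul"
    then obtain x' y' where *: "x @ y @ z = x' @ y' @ (x' \<otimes>\<^bsub>G\<^esub> y')" "x' \<in> carrier G" "y' \<in> carrier G"
      unfolding mul_def by blast
    with that G_len[of x'] G_len[of y'] have "x = x'" "y = y'" "z = x' \<otimes>\<^bsub>G\<^esub> y'" by simp_all
    then show "x \<in> carrier G \<and> y \<in> carrier G \<and> z = x \<otimes>\<^bsub>G\<^esub> y" using *(2,3) by simp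
  next
    assume "x \<in> carrier G \<and> y \<in> carrier G \<and> z = x \<otimes>\<^bsub>G\<^esub> y"
    then show "x @ y @ z \<in> mul" unfolding mul_def by blast
  qed
  define E where "E = {(x, y). x \<in> carrier G \<and> y \<in> carrier G \<and> inv\<^bsub>G\<^esub> x \<otimes>\<^bsub>G\<^esub> y \<in> N}"
  have E: "E = rcong\<^bsub>G\<^esub> N" by (auto simp: E_def r_congruent_def)
  have eqE: "equiv (carrier G) E" unfolding E by (rule subgroup.equiv_rcong) (use N.subgroup_axioms G in auto)
  have dE: "definable_set M A (n + n) {x @ y |x y. (x, y) \<in> E}"
  proof -
    have "definable_pred M A (n + n) (\<lambda>a. \<exists>t\<in>tuples n. slice (n + n) n (a @ t) \<in> N \<and>
        slice 0 n (a @ t) @ slice (n + n) n (a @ t) @ slice n n (a @ t) \<in> mul)"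
      by (intro dp_ex[where P = "\<lambda>b. slice (n + n) n b \<in> N \<and> slice 0 n b @ slice (n + n) n b @ slice n n b \<in> mul"]
          dp_and dp_slice3[OF dm] dp_slice[OF dN]) simp_all
    moreover have "{x @ y |x y. (x, y) \<in> E} = {a \<in> tuples (n + n). \<exists>t\<in>tuples n. slice (n + n) n (a @ t) \<in> N \<and>
        slice 0 n (a @ t) @ slice (n + n) n (a @ t) @ slice n n (a @ t) \<in> mul}" (is "?L = ?R")
    proof -
      have "a \<in> ?R \<longleftrightarrow> (\<exists>x y. a = x @ y \<and> (x, y) \<in> E)" for a
      proof
        assume a: "a \<in> ?R"
        then have len: "length a = n + n" by (simp add: tuples_def)
        let ?x = "slice 0 n a" and ?y = "slice n n a"
        from a obtain t where "length t = n" "t \<in> N" "?x @ t @ ?y \<in> mul"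
          using len by (auto simp: tuples_def slice_simps)
        then have "t \<in> N" "t \<in> carrier G" "?x \<in> carrier G" "?y = ?x \<otimes>\<^bsub>G\<^esub> t"
          using mult_iff[of ?x t ?y] by auto
        then have "(?x, ?y) \<in> E" by (simp add: E_def m_assoc[symmetric])
        moreover have "a = ?x @ ?y" using len by (rule slice_split)
        ultimately show "\<exists>x y. a = x @ y \<and> (x, y) \<in> E" by blast
      next
        assume "\<exists>x y. a = x @ y \<and> (x, y) \<in> E"
        then obtain x y where a: "a = x @ y" and "(x, y) \<in> E" by blast
        then have xy: "x \<in> carrier G" "y \<in> carrier G" "inv\<^bsub>G\<^esub> x \<otimes>\<^bsub>G\<^esub> y \<in> N" by (auto simp: E_def)
        let ?t = "inv\<^bsub>G\<^esub> x \<otimes>\<^bsub>G\<^esub> y"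
        have t: "?t \<in> carrier G" "y = x \<otimes>\<^bsub>G\<^esub> ?t" using xy by (auto simp: m_assoc[symmetric])
        have len: "length x = n" "length y = n" "length ?t = n" using G_len[OF xy(1)] G_len[OF xy(2)] G_len[OF t(1)] by simp_all
        then have "x @ ?t @ y \<in> mul" using mult_iff[of x ?t y] t xy by blast
        then have "\<exists>t\<in>tuples n. slice (n + n) n (a @ t) \<in> N \<and>
            slice 0 n (a @ t) @ slice (n + n) n (a @ t) @ slice n n (a @ t) \<in> mul"
          using xy(3) len by (intro bexI[of _ ?t]) (simp_all add: a tuples_def slice_simps)
        moreover have "a \<in> tuples (n + n)" using len by (simp add: a tuples_def)
        ultimately show "a \<in> ?R" by (intro CollectI conjI)
      qed
      then show ?thesis by blast
    qed
    ultimately show ?thesis by (simp add: definable_pred_def)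
  qed
  from definable_kernel[OF ei dG eqE dE] obtain k f where f: "definable_fun M A n k (carrier G) f"
    and "\<forall>x\<in>carrier G. \<forall>y\<in>carrier G. (x, y) \<in> E \<longleftrightarrow> f x = f y"
    by (elim exE conjE) (rule that)
  then have ker: "(x, y) \<in> E \<longleftrightarrow> f x = f y" if "x \<in> carrier G" "y \<in> carrier G" for x y
    using that by blast
  have f_len: "length (f x) = k" if "x \<in> carrier G" for x
    using f that by (auto simp: definable_fun_def tuples_def)
  define gr where "gr = {x @ f x |x. x \<in> carrier G}"
  have dgr: "definable_pred M A (n + k) (\<lambda>a. a \<in> gr)"
    using f by (simp add: definable_fun_def definable_set_iff_pred gr_def)
  have gr_iff: "x @ q \<in> gr \<longleftrightarrow> x \<in> carrier G \<and> q = f x" if "length x = n" for x q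
  proof
    assume "x @ q \<in> gr"
    then obtain x' where *: "x @ q = x' @ f x'" "x' \<in> carrier G" unfolding gr_def by blast
    with that G_len[of x'] have "x = x'" "q = f x'" by simp_all
    then show "x \<in> carrier G \<and> q = f x" using *(2) by simp
  next
    assume "x \<in> carrier G \<and> q = f x"
    then show "x @ q \<in> gr" unfolding gr_def by blast
  qed
  define s where "s = inv_into (carrier G) f"
  have s: "s q \<in> carrier G" "f (s q) = q" if "q \<in> f ` carrier G" for q
    using that by (auto simp: s_def inv_into_into f_inv_into_f)
  have f_mult: "f (x \<otimes>\<^bsub>G\<^esub> y) = f (x' \<otimes>\<^bsub>G\<^esub> y')"
    if "f x = f x'" "f y = f y'" "x \<in> carrier G" "y \<in> carrier G" "x' \<in> carrier G" "y' \<in> carrier G"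
    for x y x' y'
  proof -
    have "inv\<^bsub>G\<^esub> x \<otimes>\<^bsub>G\<^esub> x' \<in> N" "inv\<^bsub>G\<^esub> y \<otimes>\<^bsub>G\<^esub> y' \<in> N"
      using ker[of x x'] ker[of y y'] that by (auto simp: E_def)
    then have "inv\<^bsub>G\<^esub> y \<otimes>\<^bsub>G\<^esub> (inv\<^bsub>G\<^esub> x \<otimes>\<^bsub>G\<^esub> x') \<otimes>\<^bsub>G\<^esub> y \<otimes>\<^bsub>G\<^esub> (inv\<^bsub>G\<^esub> y \<otimes>\<^bsub>G\<^esub> y') \<in> N"
      using N.inv_op_closed1[of y "inv\<^bsub>G\<^esub> x \<otimes>\<^bsub>G\<^esub> x'"] that by - (rule N.m_closed, simp_all)
    also have "inv\<^bsub>G\<^esub> y \<otimes>\<^bsub>G\<^esub> (inv\<^bsub>G\<^esub> x \<otimes>\<^bsub>G\<^esub> x') \<otimes>\<^bsub>G\<^esub> y \<otimes>\<^bsub>G\<^esub> (inv\<^bsub>G\<^esub> y \<otimes>\<^bsub>G\<^esub> y') =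
        inv\<^bsub>G\<^esub> (x \<otimes>\<^bsub>G\<^esub> y) \<otimes>\<^bsub>G\<^esub> (x' \<otimes>\<^bsub>G\<^esub> y')"
    proof -
      have "y \<otimes>\<^bsub>G\<^esub> (inv\<^bsub>G\<^esub> y \<otimes>\<^bsub>G\<^esub> y') = y'" using that by (simp add: m_assoc[symmetric])
      then show ?thesis using that by (simp add: m_assoc inv_mult_group)
    qed
    finally have "(x \<otimes>\<^bsub>G\<^esub> y, x' \<otimes>\<^bsub>G\<^esub> y') \<in> E" using that by (simp add: E_def)
    then show ?thesis using ker[of "x \<otimes>\<^bsub>G\<^esub> y" "x' \<otimes>\<^bsub>G\<^esub> y'"] that by auto
  qed
  define Q where "Q = \<lparr>carrier = f ` carrier G, mult = \<lambda>q r. f (s q \<otimes>\<^bsub>G\<^esub> s r), one = f \<one>\<^bsub>G\<^esub>\<rparr>"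
  have multQ: "f x \<otimes>\<^bsub>Q\<^esub> f y = f (x \<otimes>\<^bsub>G\<^esub> y)" if "x \<in> carrier G" "y \<in> carrier G" for x y
    using that s[of "f x"] s[of "f y"] by (auto simp: Q_def intro!: f_mult)
  have hom: "f \<in> hom G Q"
    by (auto simp: hom_def multQ) (simp add: Q_def)
  have "Q\<lparr>carrier := f ` carrier G, one := f \<one>\<^bsub>G\<^esub>\<rparr> = Q" by (simp add: Q_def)
  with hom_imp_img_group[OF hom] have gQ: "group Q" by simp
  have epi: "f \<in> epi G Q" using hom by (simp add: epi_def Q_def)
  have "kernel G Q f = N"
  proof -
    have "x \<in> N \<longleftrightarrow> f x = f \<one>\<^bsub>G\<^esub>" if "x \<in> carrier G" for x
      using ker[of "\<one>\<^bsub>G\<^esub>" x] that by (auto simp: E_def)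
    then show ?thesis using N.subset by (auto simp: kernel_def Q_def)
  qed
  moreover have "definable_set M A k (carrier Q)"
  proof -
    have "definable_pred M A k (\<lambda>a. \<exists>g\<in>tuples n. slice k n (a @ g) @ slice 0 k (a @ g) \<in> gr)"
      by (intro dp_ex[where P = "\<lambda>b. slice k n b @ slice 0 k b \<in> gr"] dp_slice2[OF dgr]) simp_all
    moreover have "carrier Q = {a \<in> tuples k. \<exists>g\<in>tuples n. slice k n (a @ g) @ slice 0 k (a @ g) \<in> gr}"
      (is "_ = ?R")
    proof -
      have "a \<in> ?R \<longleftrightarrow> a \<in> f ` carrier G" for a
      proof
        assume a: "a \<in> ?R"
        then obtain g where "length g = n" "g @ a \<in> gr" by (auto simp: tuples_def slice_simps)
        then show "a \<in> f ` carrier G" using gr_iff[of g a] by blast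
      next
        assume "a \<in> f ` carrier G"
        then obtain g where "g \<in> carrier G" "a = f g" by blast
        then have "g @ a \<in> gr" "length g = n" "length a = k"
          using gr_iff[of g a] G_len[of g] f_len[of g] by simp_all
        then have "\<exists>g\<in>tuples n. slice k n (a @ g) @ slice 0 k (a @ g) \<in> gr" "a \<in> tuples k"
          by (auto simp: tuples_def slice_simps intro!: exI[of _ g])
        then show "a \<in> ?R" by (intro CollectI conjI)
      qed
      then show ?thesis by (auto simp: Q_def)
    qed
    ultimately show ?thesis by (simp add: definable_pred_def)
  qed
  moreover have "definable_set M A (k + k + k)
      {x @ y @ (x \<otimes>\<^bsub>Q\<^esub> y) |x y. x \<in> carrier Q \<and> y \<in> carrier Q}" (is "definable_set _ _ _ ?L")
  proof -
    let ?k = "k + k + k"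
    let ?P = "\<lambda>b. slice ?k n b @ slice 0 k b \<in> gr \<and> slice (?k + n) n b @ slice k k b \<in> gr
        \<and> slice (?k + n + n) n b @ slice (k + k) k b \<in> gr
        \<and> slice ?k n b @ slice (?k + n) n b @ slice (?k + n + n) n b \<in> mul"
    have "definable_pred M A ?k (\<lambda>a. \<exists>g\<in>tuples (n + n + n). ?P (a @ g))"
      by (intro dp_ex[where P = ?P] dp_and dp_slice3[OF dm] dp_slice2[OF dgr]) simp_all
    moreover have "?L = {a \<in> tuples ?k. \<exists>g\<in>tuples (n + n + n). ?P (a @ g)}" (is "_ = ?R")
    proof -
      have "a \<in> ?R \<longleftrightarrow> (\<exists>x y. a = x @ y @ (x \<otimes>\<^bsub>Q\<^esub> y) \<and> x \<in> carrier Q \<and> y \<in> carrier Q)" for a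
      proof
        assume a: "a \<in> ?R"
        then have len: "length a = ?k" by (simp add: tuples_def)
        from a obtain g where g: "length g = n + n + n" "?P (a @ g)" by (auto simp: tuples_def)
        let ?x = "slice 0 n g" and ?y = "slice n n g" and ?z = "slice (n + n) n g"
        let ?q = "slice 0 k a" and ?r = "slice k k a" and ?t = "slice (k + k) k a"
        have "?x @ ?q \<in> gr" "?y @ ?r \<in> gr" "?z @ ?t \<in> gr" "?x @ ?y @ ?z \<in> mul"
          using g len by (simp_all add: slice_simps)
        then have *: "?x \<in> carrier G" "?y \<in> carrier G" "?q = f ?x" "?r = f ?y" "?t = f (?x \<otimes>\<^bsub>G\<^esub> ?y)"
          using gr_iff[of ?x ?q] gr_iff[of ?y ?r] gr_iff[of ?z ?t] mult_iff[of ?x ?y ?z] by auto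
        have "a = ?q @ slice k (k + k) a" using len by (intro slice_split) simp
        also have "slice k (k + k) a = ?r @ ?t"
          using slice_split[of "slice k (k + k) a" k k] by (simp add: slice_slice)
        finally have "a = f ?x @ f ?y @ (f ?x \<otimes>\<^bsub>Q\<^esub> f ?y)" using * multQ by simp
        moreover have "f ?x \<in> carrier Q" "f ?y \<in> carrier Q" using * by (auto simp: Q_def)
        ultimately show "\<exists>x y. a = x @ y @ (x \<otimes>\<^bsub>Q\<^esub> y) \<and> x \<in> carrier Q \<and> y \<in> carrier Q" by blast
      next
        assume "\<exists>x y. a = x @ y @ (x \<otimes>\<^bsub>Q\<^esub> y) \<and> x \<in> carrier Q \<and> y \<in> carrier Q"
        then obtain x y where xy: "x \<in> carrier G" "y \<in> carrier G" and a: "a = f x @ f y @ f (x \<otimes>\<^bsub>G\<^esub> y)"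
          using multQ by (auto simp: Q_def)
        let ?z = "x \<otimes>\<^bsub>G\<^esub> y"
        have len: "length x = n" "length y = n" "length ?z = n" "length (f x) = k" "length (f y) = k" "length (f ?z) = k"
          using xy by (simp_all add: G_len f_len)
        have "x @ f x \<in> gr" "y @ f y \<in> gr" "?z @ f ?z \<in> gr" "x @ y @ ?z \<in> mul"
          using xy gr_iff[of x "f x"] gr_iff[of y "f y"] gr_iff[of ?z "f ?z"] mult_iff[of x y ?z] len by blast+
        then have "?P (a @ x @ y @ ?z)" unfolding a using len by (simp add: slice_simps)
        moreover have "x @ y @ ?z \<in> tuples (n + n + n)" "a \<in> tuples ?k" using len a by (auto simp: tuples_def)
        ultimately show "a \<in> ?R" by blast
      qed
      then show ?thesis by blast
    qed
    ultimately show ?thesis by (simp add: definable_pred_def)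
  qed
  ultimately show ?thesis
    using f epi gQ unfolding definable_quotient_def definable_group_def by blast
qed

end

theory Submission
  imports Defs
begin

text \<open>
  Right multiplication by \<open>\<Phi>\<close> trivialises the twist. Since the action on \<open>G\<close> twisted by \<open>\<Phi>\<close> is
  \<open>\<sigma> * g = \<Phi>(\<sigma>) \<sigma>(g) inv \<Phi>(\<sigma>)\<close>, the cocycle identity for \<open>\<Psi>\<close> with respect to the twisted action
  becomes the one for \<open>\<Psi>\<Phi>\<close> with respect to the original action, and \<open>b\<close> witnesses that \<open>\<Psi>\<close> and
  \<open>\<Lambda>\<close> are cohomologous for the twisted action iff it does so for \<open>\<Psi>\<Phi>\<close> and \<open>\<Lambda>\<Phi>\<close>. The inverse is
  right multiplication by the pointwise inverse of \<open>\<Phi>\<close>. So \<open>\<Psi> \<mapsto> \<Psi>\<Phi>\<close>, called \<open>translate\<close> below,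
  induces a bijection \<open>H\<^sup>1(\<G>\<^sub>\<Phi>, G) \<rightarrow> H\<^sup>1(\<G>, G)\<close> (lemma \<open>bij_betw_translate_H1\<close>).

  The same applies to the quotient \<open>Q\<close> and the cocycle \<open>\<pi> \<circ> \<Phi>\<close>. As \<open>\<pi>\<close> is a homomorphism,
  \<open>\<pi> \<circ> (\<Psi>\<Phi>) = (\<pi> \<circ> \<Psi>)(\<pi> \<circ> \<Phi>)\<close>, so the two bijections form a commutative square with the maps
  induced by \<open>\<pi>\<close> (lemma \<open>H1_map_translate\<close>). The bijection for \<open>Q\<close> sends the distinguished
  point to the class of \<open>\<pi> \<circ> \<Phi>\<close>, which is \<open>\<pi>\<^sup>1(\<mu>)\<close>. Therefore the bijection for \<open>G\<close> restricts to one
  between the kernel of the twisted map and the fibre of \<open>\<pi>\<^sup>1\<close> over \<open>\<pi>\<^sup>1(\<mu>)\<close>.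

  What remains is model theory: \<open>\<Psi>\<Phi>\<close>, \<open>\<Psi>\<close> divided by \<open>\<Phi>\<close>, and \<open>\<pi> \<circ> \<Psi>\<close> are again definable
  cochains, because definable functions can be paired and composed and both multiplication and
  division in a definable group are definable; and the automorphisms over \<open>A\<close> act on a definable
  group by homomorphisms and commute with \<open>\<pi>\<close>, because they preserve all \<open>A\<close>-definable sets.
\<close>

section \<open>Operations on definable functions\<close>

text \<open>The graph as a predicate on coordinates: in this form the closure rules for definable
  predicates apply without decomposing the tuples in a graph.\<close>

lemma definable_fun_iff_pred:
  fixes M :: "('f, 'r, 'm) fo_structure"
  shows "definable_fun M A n k D f \<longleftrightarrow> D \<subseteq> tuples n \<and> f ` D \<subseteq> tuples k
     \<and> definable_pred M A (n + k) (\<lambda>a. slice 0 n a \<in> D \<and> slice n k a = f (slice 0 n a))"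
proof -
  have "{x @ f x |x. x \<in> D}
      = {a \<in> tuples (n + k). slice 0 n a \<in> D \<and> slice n k a = f (slice 0 n a)}" (is "?L = ?R")
    if "D \<subseteq> tuples n" "f ` D \<subseteq> tuples k"
  proof
    have "length x = n" "length (f x) = k" if "x \<in> D" for x
      using that \<open>D \<subseteq> tuples n\<close> \<open>f ` D \<subseteq> tuples k\<close> by (auto simp: tuples_def)
    then show "?L \<subseteq> ?R" by (auto simp: tuples_def slice_simps)
    show "?R \<subseteq> ?L"
    proof
      fix a assume a: "a \<in> ?R"
      then have "a = slice 0 n a @ slice n k a" by (intro slice_split) (simp add: tuples_def)
      then show "a \<in> ?L" using a by auto
    qed
  qed
  then show ?thesis by (auto simp: definable_fun_def definable_pred_def)
qed

lemma definable_fun_comp: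
  fixes M :: "('f, 'r, 'm) fo_structure"
  assumes f: "definable_fun M A n k D f" and g: "definable_fun M A k m E g"
  shows "definable_fun M A n m {x \<in> D. f x \<in> E} (\<lambda>x. g (f x))"
proof -
  note f' = f[unfolded definable_fun_iff_pred] and g' = g[unfolded definable_fun_iff_pred]
  let ?P = "\<lambda>a. slice 0 n a \<in> D \<and> slice n k a = f (slice 0 n a)"
  let ?Q = "\<lambda>a. slice 0 k a \<in> E \<and> slice k m a = g (slice 0 k a)"
  let ?R = "\<lambda>b. ?P (slice 0 n b @ slice (n + m) k b) \<and> ?Q (slice (n + m) k b @ slice n m b)"
  have "definable_pred M A (n + m) (\<lambda>a. \<exists>t\<in>tuples k. ?R (a @ t))"
    by (rule dp_ex[where P = ?R, OF dp_and[OF dp_slice2[where P = ?P] dp_slice2[where P = ?Q]]])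
      (use f' g' in simp_all)
  then have "definable_pred M A (n + m) (\<lambda>a. slice 0 n a \<in> {x \<in> D. f x \<in> E}
      \<and> slice n m a = g (f (slice 0 n a)))"
  proof (rule dp_cong)
    fix a :: "'m list" assume a: "length a = n + m"
    have "length (f x) = k" if "x \<in> D" for x using f' that by (auto simp: tuples_def)
    then show "(slice 0 n a \<in> {x \<in> D. f x \<in> E} \<and> slice n m a = g (f (slice 0 n a)))
        = (\<exists>t\<in>tuples k. ?R (a @ t))"
      using a by (auto simp: tuples_def slice_simps)
  qed
  then show ?thesis using f' g' by (auto simp: definable_fun_iff_pred)
qed

lemma definable_fun_slice2:
  fixes M :: "('f, 'r, 'm) fo_structure"
  assumes f: "definable_fun M A (m + m') k D f" and le: "i + m \<le> n" "i' + m' \<le> n"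
  shows "definable_fun M A n k {u \<in> tuples n. slice i m u @ slice i' m' u \<in> D}
    (\<lambda>u. f (slice i m u @ slice i' m' u))"
proof -
  note f' = f[unfolded definable_fun_iff_pred]
  let ?P = "\<lambda>a. slice 0 (m + m') a \<in> D \<and> slice (m + m') k a = f (slice 0 (m + m') a)"
  have "definable_pred M A (n + k) (\<lambda>a. ?P (slice i m a @ slice i' m' a @ slice n k a))"
    by (rule dp_slice3[where P = ?P]) (use f' le in simp_all)
  then have "definable_pred M A (n + k) (\<lambda>a. slice 0 n a \<in> {u \<in> tuples n. slice i m u @ slice i' m' u \<in> D}
      \<and> slice n k a = f (slice i m (slice 0 n a) @ slice i' m' (slice 0 n a)))"
  proof (rule dp_cong)
    fix a :: "'m list"
    have "slice 0 (m + m') (x @ y @ z) = x @ y" "slice (m + m') k (x @ y @ z) = z"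
      if "length x = m" "length y = m'" "length z = k" for x y z :: "'m list"
      using that slice_append1[of 0 "m + m'" "x @ y" z] by (simp_all add: slice_simps)
    then show "(slice 0 n a \<in> {u \<in> tuples n. slice i m u @ slice i' m' u \<in> D}
        \<and> slice n k a = f (slice i m (slice 0 n a) @ slice i' m' (slice 0 n a)))
      = ?P (slice i m a @ slice i' m' a @ slice n k a)"
      using le by (simp add: slice_slice tuples_def)
  qed
  then show ?thesis using f' by (auto simp: definable_fun_iff_pred)
qed

lemma definable_fun_append:
  fixes M :: "('f, 'r, 'm) fo_structure"
  assumes f: "definable_fun M A n k D f" and g: "definable_fun M A n l E g"
  shows "definable_fun M A n (k + l) (D \<inter> E) (\<lambda>u. f u @ g u)"
proof -
  note f' = f[unfolded definable_fun_iff_pred] and g' = g[unfolded definable_fun_iff_pred]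
  let ?P = "\<lambda>a. slice 0 n a \<in> D \<and> slice n k a = f (slice 0 n a)"
  let ?Q = "\<lambda>a. slice 0 n a \<in> E \<and> slice n l a = g (slice 0 n a)"
  have "definable_pred M A (n + (k + l)) (\<lambda>a. ?P (slice 0 n a @ slice n k a)
      \<and> ?Q (slice 0 n a @ slice (n + k) l a))"
    by (rule dp_and[OF dp_slice2[where P = ?P] dp_slice2[where P = ?Q]]) (use f' g' in simp_all)
  then have "definable_pred M A (n + (k + l)) (\<lambda>a. slice 0 n a \<in> D \<inter> E
      \<and> slice n (k + l) a = f (slice 0 n a) @ g (slice 0 n a))"
  proof (rule dp_cong)
    fix a :: "'m list"
    have "slice n (k + l) a = slice n k a @ slice (n + k) l a"
      using slice_split[of "slice n (k + l) a" k l] by (simp add: slice_slice)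
    moreover have "length (f x) = k" if "x \<in> D" for x using f' that by (auto simp: tuples_def)
    ultimately show "(slice 0 n a \<in> D \<inter> E \<and> slice n (k + l) a = f (slice 0 n a) @ g (slice 0 n a))
       = (?P (slice 0 n a @ slice n k a) \<and> ?Q (slice 0 n a @ slice (n + k) l a))"
      by (auto simp: slice_simps)
  qed
  moreover have "(\<lambda>u. f u @ g u) ` (D \<inter> E) \<subseteq> tuples (k + l)"
    using f' g' by (fastforce simp: tuples_def)
  ultimately show ?thesis using f' by (auto simp: definable_fun_iff_pred)
qed

text \<open>Division has to be definable as well because it recovers a twisted cocycle from its
  translate.\<close>

lemma definable_fun_mult_div:
  assumes "definable_group M A X"
  obtains n where "carrier X \<subseteq> tuples n"
    "definable_fun M A (n + n) n {x @ y |x y. x \<in> carrier X \<and> y \<in> carrier X}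
       (\<lambda>u. slice 0 n u \<otimes>\<^bsub>X\<^esub> slice n n u)"
    "definable_fun M A (n + n) n {x @ y |x y. x \<in> carrier X \<and> y \<in> carrier X}
       (\<lambda>u. slice 0 n u \<otimes>\<^bsub>X\<^esub> inv\<^bsub>X\<^esub> (slice n n u))"
proof -
  let ?D = "{x @ y |x y. x \<in> carrier X \<and> y \<in> carrier X}"
  let ?mul = "{x @ y @ (x \<otimes>\<^bsub>X\<^esub> y) |x y. x \<in> carrier X \<and> y \<in> carrier X}"
  from assms obtain n where X: "group X" and dX: "definable_set M A n (carrier X)"
    and dm: "definable_set M A (n + n + n) ?mul"
    unfolding definable_group_def by blast
  interpret group X by (rule X)
  have len: "length x = n" if "x \<in> carrier X" for x
    using dX that by (auto simp: definable_set_iff_pred tuples_def)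
  have mul_iff: "x @ y @ z \<in> ?mul \<longleftrightarrow> x \<in> carrier X \<and> y \<in> carrier X \<and> z = x \<otimes>\<^bsub>X\<^esub> y"
    if "length x = n" "length y = n" for x y z
  proof
    assume "x @ y @ z \<in> ?mul"
    then obtain x' y' where *: "x @ y @ z = x' @ y' @ (x' \<otimes>\<^bsub>X\<^esub> y')" "x' \<in> carrier X" "y' \<in> carrier X"
      by blast
    with that len[of x'] len[of y'] have "x = x'" "y = y'" "z = x' \<otimes>\<^bsub>X\<^esub> y'" by simp_all
    then show "x \<in> carrier X \<and> y \<in> carrier X \<and> z = x \<otimes>\<^bsub>X\<^esub> y" using *(2,3) by simp
  qed blast
  have D_iff: "u \<in> ?D \<longleftrightarrow> slice 0 n u \<in> carrier X \<and> slice n n u \<in> carrier X" if "length u = n + n" for u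
  proof
    assume "u \<in> ?D"
    then obtain x y where "u = x @ y" "x \<in> carrier X" "y \<in> carrier X" by blast
    then show "slice 0 n u \<in> carrier X \<and> slice n n u \<in> carrier X" by (simp add: len slice_simps)
  next
    assume "slice 0 n u \<in> carrier X \<and> slice n n u \<in> carrier X"
    then show "u \<in> ?D" using slice_split[OF that] by blast
  qed
  have D: "?D \<subseteq> tuples (n + n)" by (auto simp: tuples_def len)
  have im: "(\<lambda>u. slice 0 n u \<otimes>\<^bsub>X\<^esub> slice n n u) ` ?D \<subseteq> tuples n"
    "(\<lambda>u. slice 0 n u \<otimes>\<^bsub>X\<^esub> inv\<^bsub>X\<^esub> (slice n n u)) ` ?D \<subseteq> tuples n"
    by (auto simp: tuples_def len slice_simps)
  have mul: "definable_pred M A (n + n + n) (\<lambda>a. a \<in> ?mul)"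
    using dm by (simp add: definable_set_iff_pred)
  have "definable_pred M A (n + n + n) (\<lambda>a. slice 0 n a @ slice n n a @ slice (n + n) n a \<in> ?mul)"
    by (rule dp_slice3[OF mul]) simp_all
  then have 1: "definable_pred M A (n + n + n) (\<lambda>a. slice 0 (n + n) a \<in> ?D \<and> slice (n + n) n a =
      slice 0 n (slice 0 (n + n) a) \<otimes>\<^bsub>X\<^esub> slice n n (slice 0 (n + n) a))"
    by (rule dp_cong) (simp only: D_iff mul_iff length_slice, simp add: slice_slice)
  have div: "x \<in> carrier X \<and> y \<in> carrier X \<and> z = x \<otimes>\<^bsub>X\<^esub> inv\<^bsub>X\<^esub> y
      \<longleftrightarrow> z \<in> carrier X \<and> y \<in> carrier X \<and> x = z \<otimes>\<^bsub>X\<^esub> y" for x y z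
    by (auto simp: m_assoc)
  \<comment> \<open>The graph of division is that of multiplication with the coordinates permuted.\<close>
  have "definable_pred M A (n + n + n) (\<lambda>a. slice (n + n) n a @ slice n n a @ slice 0 n a \<in> ?mul)"
    by (rule dp_slice3[OF mul]) simp_all
  then have 2: "definable_pred M A (n + n + n) (\<lambda>a. slice 0 (n + n) a \<in> ?D \<and> slice (n + n) n a =
      slice 0 n (slice 0 (n + n) a) \<otimes>\<^bsub>X\<^esub> inv\<^bsub>X\<^esub> (slice n n (slice 0 (n + n) a)))"
    by (rule dp_cong) (simp only: D_iff mul_iff length_slice conj_assoc div[symmetric], simp add: slice_slice)
  show thesis
  proof (rule that)
    show "carrier X \<subseteq> tuples n" by (auto simp: tuples_def len)
  qed (use D im 1 2 in \<open>simp_all only: definable_fun_iff_pred simp_thms\<close>)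
qed

section \<open>Automorphisms and definability\<close>

lemma id_in_Aut: "id \<in> Aut M A"
  by (simp add: Aut_def)

lemma comp_in_Aut:
  assumes \<sigma>: "\<sigma> \<in> Aut M A" and \<tau>: "\<tau> \<in> Aut M A"
  shows "\<sigma> \<circ> \<tau> \<in> Aut M A"
proof -
  have "rel_interp M r (map (\<sigma> \<circ> \<tau>) xs) = rel_interp M r xs" if "rel_arity M r = Some (length xs)" for r xs
  proof -
    have "rel_interp M r (map \<sigma> (map \<tau> xs)) = rel_interp M r (map \<tau> xs)"
      using \<sigma> that by (simp add: Aut_def del: map_map)
    then show ?thesis using \<tau> that by (simp add: Aut_def)
  qed
  moreover have "(\<sigma> \<circ> \<tau>) (fun_interp M f xs) = fun_interp M f (map (\<sigma> \<circ> \<tau>) xs)"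
    if "fun_arity M f = Some (length xs)" for f xs
  proof -
    have "\<sigma> (fun_interp M f (map \<tau> xs)) = fun_interp M f (map \<sigma> (map \<tau> xs))"
      using \<sigma> that by (simp add: Aut_def del: map_map)
    then show ?thesis using \<tau> that by (simp add: Aut_def)
  qed
  ultimately show ?thesis
    using assms by (simp add: Aut_def bij_comp del: o_apply) (simp add: Aut_def)
qed

text \<open>Automorphisms fixing \<open>A\<close> preserve the truth of formulas over \<open>A\<close>, hence every \<open>A\<close>-definable
  set. Applied to graphs, this makes \<open>A\<close>-definable functions equivariant.\<close>

lemma tm_val_Aut:
  assumes "\<sigma> \<in> Aut M A"
  shows "tm_wf M t \<Longrightarrow> tm_consts t \<subseteq> A \<Longrightarrow> tm_val M (\<lambda>i. \<sigma> (v i)) t = \<sigma> (tm_val M v t)"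
proof (induction t)
  case (Fun f ts)
  have "map (tm_val M (\<lambda>i. \<sigma> (v i))) ts = map \<sigma> (map (tm_val M v) ts)"
    using Fun by auto
  moreover have "\<sigma> (fun_interp M f (map (tm_val M v) ts)) = fun_interp M f (map \<sigma> (map (tm_val M v) ts))"
    using assms Fun.prems(1) by (simp add: Aut_def del: map_map)
  ultimately show ?case by (simp only: tm_val.simps)
qed (use assms in \<open>auto simp: Aut_def\<close>)

lemma sat_Aut:
  assumes \<sigma>: "\<sigma> \<in> Aut M A"
  shows "fm_wf M \<phi> \<Longrightarrow> fm_consts \<phi> \<subseteq> A \<Longrightarrow> sat M (\<lambda>i. \<sigma> (v i)) \<phi> = sat M v \<phi>"
proof (induction \<phi> arbitrary: v)
  case (Eq s t)
  then show ?case using \<sigma> by (auto simp: tm_val_Aut[OF \<sigma>] Aut_def dest: bij_is_inj injD)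
next
  case (Rel r ts)
  have "map (tm_val M (\<lambda>i. \<sigma> (v i))) ts = map \<sigma> (map (tm_val M v) ts)"
    using Rel by (auto intro!: tm_val_Aut[OF \<sigma>])
  moreover have "rel_interp M r (map \<sigma> (map (tm_val M v) ts)) = rel_interp M r (map (tm_val M v) ts)"
    using \<sigma> Rel.prems(1) by (simp add: Aut_def del: map_map)
  ultimately show ?case by (simp only: sat.simps)
next
  case (Ex i \<phi>)
  have upd: "(\<lambda>i. \<sigma> (v i))(i := \<sigma> c) = (\<lambda>j. \<sigma> ((v(i := c)) j))" for c by auto
  have step: "sat M ((\<lambda>i. \<sigma> (v i))(i := \<sigma> c)) \<phi> = sat M (v(i := c)) \<phi>" for c
    unfolding upd by (rule Ex.IH) (use Ex.prems in simp_all)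
  have "surj \<sigma>" using \<sigma> by (simp add: Aut_def bij_is_surj)
  then have "sat M (\<lambda>i. \<sigma> (v i)) (Ex i \<phi>) \<longleftrightarrow> (\<exists>c. sat M ((\<lambda>i. \<sigma> (v i))(i := \<sigma> c)) \<phi>)"
    unfolding sat.simps by (metis surjD)
  then show ?case by (simp only: step sat.simps)
qed auto

lemma definable_set_Aut:
  assumes "definable_set M A n X" "\<sigma> \<in> Aut M A" "x \<in> X"
  shows "map \<sigma> x \<in> X"
proof -
  from assms(1) obtain \<phi> where \<phi>: "\<phi> \<in> formulas M A n" and X: "X = {a \<in> tuples n. holds M \<phi> a}"
    unfolding definable_set_def by blast
  have "holds M \<phi> (map \<sigma> x) = sat M (\<lambda>i. \<sigma> (x ! i)) \<phi>"
    unfolding holds_def by (rule sat_cong) (use \<phi> X assms(3) in \<open>auto simp: formulas_def tuples_def\<close>)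
  also have "\<dots> = holds M \<phi> x"
    using \<phi> by (simp add: formulas_def holds_def sat_Aut[OF assms(2)])
  finally show ?thesis using X assms(3) by (simp add: tuples_def)
qed

lemma definable_fun_Aut:
  assumes f: "definable_fun M A n k D f" and "\<sigma> \<in> Aut M A" "x \<in> D"
  shows "map \<sigma> x \<in> D" "map \<sigma> (f x) = f (map \<sigma> x)"
proof -
  have "map \<sigma> (x @ f x) \<in> {x @ f x |x. x \<in> D}"
    using assms by (intro definable_set_Aut) (auto simp: definable_fun_def)
  then obtain y where "map \<sigma> x @ map \<sigma> (f x) = y @ f y" "y \<in> D" by auto
  moreover from this have "length (map \<sigma> x) = length y"
    using f \<open>x \<in> D\<close> by (auto simp: definable_fun_def tuples_def)
  ultimately show "map \<sigma> x \<in> D" "map \<sigma> (f x) = f (map \<sigma> x)" by auto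
qed

lemma definable_group_Aut:
  assumes X: "definable_group M A X" and \<sigma>: "\<sigma> \<in> Aut M A"
  shows "map \<sigma> \<in> hom X X"
proof -
  from X obtain n where n: "carrier X \<subseteq> tuples n" and m: "definable_fun M A (n + n) n
      {x @ y |x y. x \<in> carrier X \<and> y \<in> carrier X} (\<lambda>u. slice 0 n u \<otimes>\<^bsub>X\<^esub> slice n n u)"
    by (rule definable_fun_mult_div)
  have closed: "map \<sigma> x \<in> carrier X" if "x \<in> carrier X" for x
    using X definable_set_Aut[OF _ \<sigma> that] by (auto simp: definable_group_def)
  have "map \<sigma> (x \<otimes>\<^bsub>X\<^esub> y) = map \<sigma> x \<otimes>\<^bsub>X\<^esub> map \<sigma> y" if "x \<in> carrier X" "y \<in> carrier X" for x y
  proof -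
    have "length x = n" "length y = n" using n that by (auto simp: tuples_def)
    then show ?thesis
      using definable_fun_Aut(2)[OF m \<sigma>, of "x @ y"] that by (auto simp: slice_simps)
  qed
  with closed show ?thesis by (auto simp: hom_def)
qed

section \<open>Definable cochains\<close>

text \<open>Definability of a map on the automorphisms, separated from the cocycle identity: the closure
  properties below hold for arbitrary maps of this form.\<close>

definition definable_cochain ::
    "('f, 'r, 'm) fo_structure \<Rightarrow> 'm set \<Rightarrow> (('m \<Rightarrow> 'm) \<Rightarrow> 'm list) \<Rightarrow> bool" where
  "definable_cochain M A c \<longleftrightarrow> (\<exists>a k D h. definable_fun M A (length a + length a) k D h
     \<and> (\<forall>\<sigma>\<in>Aut M A. a @ map \<sigma> a \<in> D \<and> c \<sigma> = h (a @ map \<sigma> a)))"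

lemma definable_Z1_iff:
  "\<Phi> \<in> definable_Z1 M A X act \<longleftrightarrow> \<Phi> \<in> Aut M A \<rightarrow>\<^sub>E carrier X
     \<and> (\<forall>\<sigma>\<in>Aut M A. \<forall>\<tau>\<in>Aut M A. \<Phi> (\<sigma> \<circ> \<tau>) = \<Phi> \<sigma> \<otimes>\<^bsub>X\<^esub> act \<sigma> (\<Phi> \<tau>))
     \<and> definable_cochain M A \<Phi>"
  by (simp add: definable_Z1_def definable_cochain_def)

lemma definable_cochain_cong:
  assumes "definable_cochain M A c" "\<And>\<sigma>. \<sigma> \<in> Aut M A \<Longrightarrow> d \<sigma> = c \<sigma>"
  shows "definable_cochain M A d"
  using assms by (simp add: definable_cochain_def)

lemma definable_cochain_comp:
  assumes c: "definable_cochain M A c" and F: "definable_fun M A n m E F"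
    and E: "\<And>\<sigma>. \<sigma> \<in> Aut M A \<Longrightarrow> c \<sigma> \<in> E"
  shows "definable_cochain M A (\<lambda>\<sigma>. F (c \<sigma>))"
proof -
  from c obtain a k D h where h: "definable_fun M A (length a + length a) k D h"
    and c_eq: "\<And>\<sigma>. \<sigma> \<in> Aut M A \<Longrightarrow> a @ map \<sigma> a \<in> D \<and> c \<sigma> = h (a @ map \<sigma> a)"
    by (auto simp: definable_cochain_def)
  \<comment> \<open>The length of the values of the cochain can be read off at the identity automorphism.\<close>
  have "c id \<in> tuples k" "c id \<in> tuples n"
    using h c_eq[OF id_in_Aut] F E[OF id_in_Aut] by (auto simp: definable_fun_def)
  then have "n = k" by (simp add: tuples_def)
  show ?thesis unfolding definable_cochain_def
    by (intro exI conjI, rule definable_fun_comp[OF h F[unfolded \<open>n = k\<close>]])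
      (use c_eq E in fastforce)
qed

text \<open>If the two cochains are given by tuples \<open>a\<close> and \<open>b\<close>, the pair is given by \<open>a @ b\<close>: the blocks
  \<open>a\<close>, \<open>\<sigma>(a)\<close> and \<open>b\<close>, \<open>\<sigma>(b)\<close> are interleaved in \<open>a @ b @ \<sigma>(a) @ \<sigma>(b)\<close>.\<close>

lemma definable_cochain_append:
  assumes c: "definable_cochain M A c" and d: "definable_cochain M A d"
  shows "definable_cochain M A (\<lambda>\<sigma>. c \<sigma> @ d \<sigma>)"
proof -
  from c obtain a k D h where h: "definable_fun M A (length a + length a) k D h"
    and c_eq: "\<And>\<sigma>. \<sigma> \<in> Aut M A \<Longrightarrow> a @ map \<sigma> a \<in> D \<and> c \<sigma> = h (a @ map \<sigma> a)"
    by (auto simp: definable_cochain_def)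
  from d obtain b l E g where g: "definable_fun M A (length b + length b) l E g"
    and d_eq: "\<And>\<sigma>. \<sigma> \<in> Aut M A \<Longrightarrow> b @ map \<sigma> b \<in> E \<and> d \<sigma> = g (b @ map \<sigma> b)"
    by (auto simp: definable_cochain_def)
  let ?p = "length a" and ?q = "length b"
  let ?n = "length (a @ b) + length (a @ b)"
  have "definable_fun M A ?n k {u \<in> tuples ?n. slice 0 ?p u @ slice (?p + ?q) ?p u \<in> D}
      (\<lambda>u. h (slice 0 ?p u @ slice (?p + ?q) ?p u))"
    by (rule definable_fun_slice2[OF h]) simp_all
  moreover have "definable_fun M A ?n l {u \<in> tuples ?n. slice ?p ?q u @ slice (?p + ?q + ?p) ?q u \<in> E}
      (\<lambda>u. g (slice ?p ?q u @ slice (?p + ?q + ?p) ?q u))"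
    by (rule definable_fun_slice2[OF g]) simp_all
  ultimately have "definable_fun M A ?n (k + l)
      ({u \<in> tuples ?n. slice 0 ?p u @ slice (?p + ?q) ?p u \<in> D}
        \<inter> {u \<in> tuples ?n. slice ?p ?q u @ slice (?p + ?q + ?p) ?q u \<in> E})
      (\<lambda>u. h (slice 0 ?p u @ slice (?p + ?q) ?p u) @ g (slice ?p ?q u @ slice (?p + ?q + ?p) ?q u))"
    by (rule definable_fun_append)
  then show ?thesis unfolding definable_cochain_def
    by (intro exI conjI, assumption) (use c_eq d_eq in \<open>auto simp: tuples_def slice_simps\<close>)
qed

lemma definable_cochain_mult_div:
  assumes X: "definable_group M A X"
    and c: "definable_cochain M A c" "\<And>\<sigma>. \<sigma> \<in> Aut M A \<Longrightarrow> c \<sigma> \<in> carrier X"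
    and d: "definable_cochain M A d" "\<And>\<sigma>. \<sigma> \<in> Aut M A \<Longrightarrow> d \<sigma> \<in> carrier X"
  shows "definable_cochain M A (\<lambda>\<sigma>. c \<sigma> \<otimes>\<^bsub>X\<^esub> d \<sigma>)"
    and "definable_cochain M A (\<lambda>\<sigma>. c \<sigma> \<otimes>\<^bsub>X\<^esub> inv\<^bsub>X\<^esub> (d \<sigma>))"
proof -
  from X obtain n where n: "carrier X \<subseteq> tuples n"
    and *: "definable_fun M A (n + n) n {x @ y |x y. x \<in> carrier X \<and> y \<in> carrier X}
       (\<lambda>u. slice 0 n u \<otimes>\<^bsub>X\<^esub> slice n n u)"
      "definable_fun M A (n + n) n {x @ y |x y. x \<in> carrier X \<and> y \<in> carrier X}
       (\<lambda>u. slice 0 n u \<otimes>\<^bsub>X\<^esub> inv\<^bsub>X\<^esub> (slice n n u))"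
    by (rule definable_fun_mult_div)
  note ** = *[THEN definable_cochain_comp[OF definable_cochain_append[OF c(1) d(1)]]]
  have len: "length (c \<sigma>) = n" "length (d \<sigma>) = n" if "\<sigma> \<in> Aut M A" for \<sigma>
    using n c(2)[OF that] d(2)[OF that] by (auto simp: tuples_def)
  show "definable_cochain M A (\<lambda>\<sigma>. c \<sigma> \<otimes>\<^bsub>X\<^esub> d \<sigma>)"
    by (rule definable_cochain_cong[OF **(1)]) (use c(2) d(2) len in \<open>auto simp: slice_simps\<close>)
  show "definable_cochain M A (\<lambda>\<sigma>. c \<sigma> \<otimes>\<^bsub>X\<^esub> inv\<^bsub>X\<^esub> (d \<sigma>))"
    by (rule definable_cochain_cong[OF **(2)]) (use c(2) d(2) len in \<open>auto simp: slice_simps\<close>)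
qed

section \<open>Cohomology classes\<close>

lemma equiv_cohomologous:
  assumes X: "definable_group M A X"
  shows "equiv (definable_Z1 M A X map) (cohomologous M A X map)"
proof -
  interpret group X using X by (simp add: definable_group_def)
  note hom = definable_group_Aut[OF X]
  have cl: "map \<sigma> x \<in> carrier X" if "\<sigma> \<in> Aut M A" "x \<in> carrier X" for \<sigma> x
    using hom_in_carrier[OF hom[OF that(1)] that(2)] .
  have mult: "map \<sigma> (x \<otimes>\<^bsub>X\<^esub> y) = map \<sigma> x \<otimes>\<^bsub>X\<^esub> map \<sigma> y"
    if "\<sigma> \<in> Aut M A" "x \<in> carrier X" "y \<in> carrier X" for \<sigma> x y
    using hom_mult[OF hom[OF that(1)] that(2,3)] .
  have hom': "group_hom X X (map \<sigma>)" if "\<sigma> \<in> Aut M A" for \<sigma>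
    using hom[OF that] by unfold_locales
  have one: "map \<sigma> \<one>\<^bsub>X\<^esub> = \<one>\<^bsub>X\<^esub>" if "\<sigma> \<in> Aut M A" for \<sigma>
    using group_hom.hom_one[OF hom'[OF that]] .
  have invs: "map \<sigma> (inv\<^bsub>X\<^esub> x) = inv\<^bsub>X\<^esub> (map \<sigma> x)" if "\<sigma> \<in> Aut M A" "x \<in> carrier X" for \<sigma> x
    using group_hom.hom_inv[OF hom'[OF that(1)] that(2)] .
  have Zc: "\<Phi> \<sigma> \<in> carrier X" if "\<Phi> \<in> definable_Z1 M A X map" "\<sigma> \<in> Aut M A" for \<Phi> \<sigma>
    using that by (auto simp: definable_Z1_iff)
  show ?thesis
  proof (rule equivI)
    show "cohomologous M A X map \<subseteq> definable_Z1 M A X map \<times> definable_Z1 M A X map"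
      by (auto simp: cohomologous_def)
    show "refl_on (definable_Z1 M A X map) (cohomologous M A X map)"
      by (auto simp: refl_on_def cohomologous_def one Zc intro!: bexI[of _ "\<one>\<^bsub>X\<^esub>"])
    show "sym (cohomologous M A X map)"
    proof (rule symI)
      fix \<Phi> \<Psi> assume "(\<Phi>, \<Psi>) \<in> cohomologous M A X map"
      then obtain b where Z: "\<Phi> \<in> definable_Z1 M A X map" "\<Psi> \<in> definable_Z1 M A X map"
        and b: "b \<in> carrier X"
        and eq: "\<And>\<sigma>. \<sigma> \<in> Aut M A \<Longrightarrow> \<Psi> \<sigma> = inv\<^bsub>X\<^esub> b \<otimes>\<^bsub>X\<^esub> \<Phi> \<sigma> \<otimes>\<^bsub>X\<^esub> map \<sigma> b"
        by (auto simp: cohomologous_def)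
      have "\<Phi> \<sigma> = inv\<^bsub>X\<^esub> (inv\<^bsub>X\<^esub> b) \<otimes>\<^bsub>X\<^esub> \<Psi> \<sigma> \<otimes>\<^bsub>X\<^esub> map \<sigma> (inv\<^bsub>X\<^esub> b)"
        if "\<sigma> \<in> Aut M A" for \<sigma>
        using that b Zc[OF Z(1) that] cl[OF that b] m_assoc[of b "inv\<^bsub>X\<^esub> b", symmetric]
        by (simp add: eq invs m_assoc)
      then show "(\<Psi>, \<Phi>) \<in> cohomologous M A X map"
        unfolding cohomologous_def using Z inv_closed[OF b] by blast
    qed
    show "trans (cohomologous M A X map)"
    proof (rule transI)
      fix \<Phi> \<Psi> \<Theta>
      assume "(\<Phi>, \<Psi>) \<in> cohomologous M A X map" "(\<Psi>, \<Theta>) \<in> cohomologous M A X map"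
      then obtain b c where Z: "\<Phi> \<in> definable_Z1 M A X map" "\<Theta> \<in> definable_Z1 M A X map"
        and b: "b \<in> carrier X" and c: "c \<in> carrier X"
        and eq: "\<And>\<sigma>. \<sigma> \<in> Aut M A \<Longrightarrow> \<Psi> \<sigma> = inv\<^bsub>X\<^esub> b \<otimes>\<^bsub>X\<^esub> \<Phi> \<sigma> \<otimes>\<^bsub>X\<^esub> map \<sigma> b"
          "\<And>\<sigma>. \<sigma> \<in> Aut M A \<Longrightarrow> \<Theta> \<sigma> = inv\<^bsub>X\<^esub> c \<otimes>\<^bsub>X\<^esub> \<Psi> \<sigma> \<otimes>\<^bsub>X\<^esub> map \<sigma> c"
        unfolding cohomologous_def by blast
      have "\<Theta> \<sigma> = inv\<^bsub>X\<^esub> (b \<otimes>\<^bsub>X\<^esub> c) \<otimes>\<^bsub>X\<^esub> \<Phi> \<sigma> \<otimes>\<^bsub>X\<^esub> map \<sigma> (b \<otimes>\<^bsub>X\<^esub> c)"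
        if "\<sigma> \<in> Aut M A" for \<sigma>
        using that b c Zc[OF Z(1) that] by (simp add: eq mult cl inv_mult_group m_assoc)
      then show "(\<Phi>, \<Theta>) \<in> cohomologous M A X map"
        unfolding cohomologous_def using Z m_closed[OF b c] by blast
    qed
  qed
qed

lemma cohomologous_hom:
  assumes h: "h \<in> hom X Y" and X: "group X" and Y: "group Y"
    and eqv: "\<And>\<sigma> x. \<sigma> \<in> Aut M A \<Longrightarrow> x \<in> carrier X \<Longrightarrow> map \<sigma> x \<in> carrier X \<and> h (map \<sigma> x) = map \<sigma> (h x)"
    and Z: "\<And>\<Psi>. \<Psi> \<in> definable_Z1 M A X map \<Longrightarrow> compose (Aut M A) h \<Psi> \<in> definable_Z1 M A Y map"
    and "(\<Phi>, \<Psi>) \<in> cohomologous M A X map"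
  shows "(compose (Aut M A) h \<Phi>, compose (Aut M A) h \<Psi>) \<in> cohomologous M A Y map"
proof -
  interpret X: group X by (rule X)
  interpret group_hom X Y h by (intro group_hom.intro group_hom_axioms.intro X Y h)
  from assms(6) obtain b where Zs: "\<Phi> \<in> definable_Z1 M A X map" "\<Psi> \<in> definable_Z1 M A X map"
    and b: "b \<in> carrier X"
    and eq: "\<And>\<sigma>. \<sigma> \<in> Aut M A \<Longrightarrow> \<Psi> \<sigma> = inv\<^bsub>X\<^esub> b \<otimes>\<^bsub>X\<^esub> \<Phi> \<sigma> \<otimes>\<^bsub>X\<^esub> map \<sigma> b"
    by (auto simp: cohomologous_def)
  have "h (\<Psi> \<sigma>) = inv\<^bsub>Y\<^esub> (h b) \<otimes>\<^bsub>Y\<^esub> h (\<Phi> \<sigma>) \<otimes>\<^bsub>Y\<^esub> map \<sigma> (h b)" if "\<sigma> \<in> Aut M A" for \<sigma>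
  proof -
    have "\<Phi> \<sigma> \<in> carrier X" using Zs(1) that by (auto simp: definable_Z1_iff)
    then show ?thesis using that b eqv[OF that b] by (simp add: eq)
  qed
  then have "\<forall>\<sigma>\<in>Aut M A. compose (Aut M A) h \<Psi> \<sigma>
      = inv\<^bsub>Y\<^esub> (h b) \<otimes>\<^bsub>Y\<^esub> compose (Aut M A) h \<Phi> \<sigma> \<otimes>\<^bsub>Y\<^esub> map \<sigma> (h b)"
    by (simp add: compose_def)
  then show ?thesis
    unfolding cohomologous_def using Z[OF Zs(1)] Z[OF Zs(2)] hom_closed[OF b] by blast
qed

section \<open>Twisting\<close>

definition translate :: "('f, 'r, 'm) fo_structure \<Rightarrow> 'm set \<Rightarrow> 'm list monoid
    \<Rightarrow> (('m \<Rightarrow> 'm) \<Rightarrow> 'm list) \<Rightarrow> (('m \<Rightarrow> 'm) \<Rightarrow> 'm list) \<Rightarrow> ('m \<Rightarrow> 'm) \<Rightarrow> 'm list" where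
  "translate M A X \<Phi> \<Psi> = (\<lambda>\<sigma>\<in>Aut M A. \<Psi> \<sigma> \<otimes>\<^bsub>X\<^esub> \<Phi> \<sigma>)"

lemma bij_betw_translate:
  assumes "group X" and \<Phi>: "\<Phi> \<in> Aut M A \<rightarrow>\<^sub>E carrier X"
  shows "bij_betw (translate M A X \<Phi>) (Aut M A \<rightarrow>\<^sub>E carrier X) (Aut M A \<rightarrow>\<^sub>E carrier X)"
proof -
  interpret group X by fact
  have c: "\<Psi> \<sigma> \<in> carrier X" if "\<Psi> \<in> Aut M A \<rightarrow>\<^sub>E carrier X" "\<sigma> \<in> Aut M A" for \<Psi> \<sigma>
    using that by auto
  have ext: "\<Psi> \<sigma> = undefined" if "\<Psi> \<in> Aut M A \<rightarrow>\<^sub>E carrier X" "\<sigma> \<notin> Aut M A" for \<Psi> \<sigma>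
    using that by auto
  show ?thesis
    by (rule bij_betw_byWitness[where f' = "\<lambda>\<Theta>. \<lambda>\<sigma>\<in>Aut M A. \<Theta> \<sigma> \<otimes>\<^bsub>X\<^esub> inv\<^bsub>X\<^esub> (\<Phi> \<sigma>)"])
      (auto simp: translate_def fun_eq_iff restrict_def m_assoc c c[OF \<Phi>] ext)
qed

text \<open>Multiplying the twisted cocycle identity
  \<open>\<Psi>(\<sigma>\<tau>) = \<Psi>(\<sigma>) \<Phi>(\<sigma>) \<sigma>(\<Psi>(\<tau>)) inv \<Phi>(\<sigma>)\<close> on the right by \<open>\<Phi>(\<sigma>\<tau>) = \<Phi>(\<sigma>) \<sigma>(\<Phi>(\<tau>))\<close> gives
  the untwisted one for \<open>\<Psi>\<Phi>\<close>. Definability passes from \<open>\<Psi>\<close> to \<open>\<Psi>\<Phi>\<close> and back because the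
  definable cochains are closed under multiplication and division.\<close>

lemma translate_in_Z1_iff:
  assumes X: "definable_group M A X" and \<Phi>: "\<Phi> \<in> definable_Z1 M A X map"
    and \<Psi>: "\<Psi> \<in> Aut M A \<rightarrow>\<^sub>E carrier X"
  shows "translate M A X \<Phi> \<Psi> \<in> definable_Z1 M A X map \<longleftrightarrow> \<Psi> \<in> definable_Z1 M A X (twist X \<Phi>)"
proof -
  interpret group X using X by (simp add: definable_group_def)
  have \<Phi>c: "\<Phi> \<sigma> \<in> carrier X" and \<Psi>c: "\<Psi> \<sigma> \<in> carrier X" if "\<sigma> \<in> Aut M A" for \<sigma>
    using \<Phi> \<Psi> that by (auto simp: definable_Z1_iff)
  have \<Phi>d: "definable_cochain M A \<Phi>" using \<Phi> by (simp add: definable_Z1_iff)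
  let ?T = "translate M A X \<Phi> \<Psi>"
  have cocycle: "?T (\<sigma> \<circ> \<tau>) = ?T \<sigma> \<otimes>\<^bsub>X\<^esub> map \<sigma> (?T \<tau>)
      \<longleftrightarrow> \<Psi> (\<sigma> \<circ> \<tau>) = \<Psi> \<sigma> \<otimes>\<^bsub>X\<^esub> twist X \<Phi> \<sigma> (\<Psi> \<tau>)"
    if \<sigma>: "\<sigma> \<in> Aut M A" and \<tau>: "\<tau> \<in> Aut M A" for \<sigma> \<tau>
  proof -
    note c = \<Phi>c[OF \<sigma>] \<Phi>c[OF \<tau>] \<Psi>c[OF \<sigma>] \<Psi>c[OF \<tau>] \<Psi>c[OF comp_in_Aut[OF \<sigma> \<tau>]]
    note hom = definable_group_Aut[OF X \<sigma>]
    note c' = hom_in_carrier[OF hom c(2)] hom_in_carrier[OF hom c(4)]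
    have \<Phi>_eq: "\<Phi> (\<sigma> \<circ> \<tau>) = \<Phi> \<sigma> \<otimes>\<^bsub>X\<^esub> map \<sigma> (\<Phi> \<tau>)"
      using \<Phi> \<sigma> \<tau> by (simp add: definable_Z1_iff)
    have cancel: "inv\<^bsub>X\<^esub> (\<Phi> \<sigma>) \<otimes>\<^bsub>X\<^esub> (\<Phi> \<sigma> \<otimes>\<^bsub>X\<^esub> map \<sigma> (\<Phi> \<tau>)) = map \<sigma> (\<Phi> \<tau>)"
      using c c' by (simp flip: m_assoc)
    have "?T \<sigma> \<otimes>\<^bsub>X\<^esub> map \<sigma> (?T \<tau>) = (\<Psi> \<sigma> \<otimes>\<^bsub>X\<^esub> twist X \<Phi> \<sigma> (\<Psi> \<tau>)) \<otimes>\<^bsub>X\<^esub> \<Phi> (\<sigma> \<circ> \<tau>)"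
      using \<sigma> \<tau> c c' cancel
      by (simp add: translate_def twist_def \<Phi>_eq hom_mult[OF hom] m_assoc)
    moreover have "?T (\<sigma> \<circ> \<tau>) = \<Psi> (\<sigma> \<circ> \<tau>) \<otimes>\<^bsub>X\<^esub> \<Phi> (\<sigma> \<circ> \<tau>)"
      using comp_in_Aut[OF \<sigma> \<tau>] by (simp add: translate_def)
    moreover have "\<Psi> \<sigma> \<otimes>\<^bsub>X\<^esub> twist X \<Phi> \<sigma> (\<Psi> \<tau>) \<in> carrier X" using c c' by (simp add: twist_def)
    ultimately show ?thesis using c(5) \<Phi>c[OF comp_in_Aut[OF \<sigma> \<tau>]] by simp
  qed
  have Tc: "?T \<sigma> \<in> carrier X" if "\<sigma> \<in> Aut M A" for \<sigma>
    using that \<Phi>c \<Psi>c by (simp add: translate_def)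
  have "definable_cochain M A ?T \<longleftrightarrow> definable_cochain M A \<Psi>"
  proof
    assume "definable_cochain M A ?T"
    from definable_cochain_mult_div(2)[OF X this Tc \<Phi>d \<Phi>c]
    show "definable_cochain M A \<Psi>"
      by (rule definable_cochain_cong) (use \<Phi>c \<Psi>c in \<open>simp_all add: translate_def m_assoc\<close>)
  next
    assume "definable_cochain M A \<Psi>"
    from definable_cochain_mult_div(1)[OF X this \<Psi>c \<Phi>d \<Phi>c]
    show "definable_cochain M A ?T"
      by (rule definable_cochain_cong) (simp_all add: translate_def)
  qed
  moreover have "?T \<in> Aut M A \<rightarrow>\<^sub>E carrier X" using Tc by (auto simp: translate_def)
  ultimately show ?thesis using \<Psi> cocycle by (simp add: definable_Z1_iff)
qed

text \<open>The factor \<open>inv \<Phi>(\<sigma>)\<close> at the end of the twisted coboundary relation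
  \<open>\<Lambda>(\<sigma>) = inv b \<Psi>(\<sigma>) \<Phi>(\<sigma>) \<sigma>(b) inv \<Phi>(\<sigma>)\<close> moves to the other side, so the same \<open>b\<close>
  witnesses both relations.\<close>

lemma translate_cohomologous_iff:
  assumes X: "definable_group M A X" and \<Phi>: "\<Phi> \<in> definable_Z1 M A X map"
    and \<Psi>: "\<Psi> \<in> Aut M A \<rightarrow>\<^sub>E carrier X" and \<Lambda>: "\<Lambda> \<in> Aut M A \<rightarrow>\<^sub>E carrier X"
  shows "(translate M A X \<Phi> \<Psi>, translate M A X \<Phi> \<Lambda>) \<in> cohomologous M A X map
    \<longleftrightarrow> (\<Psi>, \<Lambda>) \<in> cohomologous M A X (twist X \<Phi>)"
proof -
  interpret group X using X by (simp add: definable_group_def)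
  have "translate M A X \<Phi> \<Lambda> \<sigma> = inv\<^bsub>X\<^esub> b \<otimes>\<^bsub>X\<^esub> translate M A X \<Phi> \<Psi> \<sigma> \<otimes>\<^bsub>X\<^esub> map \<sigma> b
      \<longleftrightarrow> \<Lambda> \<sigma> = inv\<^bsub>X\<^esub> b \<otimes>\<^bsub>X\<^esub> \<Psi> \<sigma> \<otimes>\<^bsub>X\<^esub> twist X \<Phi> \<sigma> b"
    if \<sigma>: "\<sigma> \<in> Aut M A" and b: "b \<in> carrier X" for \<sigma> b
  proof -
    have c: "\<Phi> \<sigma> \<in> carrier X" "\<Psi> \<sigma> \<in> carrier X" "\<Lambda> \<sigma> \<in> carrier X" "map \<sigma> b \<in> carrier X"
      using \<Phi> \<Psi> \<Lambda> \<sigma> hom_in_carrier[OF definable_group_Aut[OF X \<sigma>] b] by (auto simp: definable_Z1_iff)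
    have "inv\<^bsub>X\<^esub> b \<otimes>\<^bsub>X\<^esub> translate M A X \<Phi> \<Psi> \<sigma> \<otimes>\<^bsub>X\<^esub> map \<sigma> b
        = (inv\<^bsub>X\<^esub> b \<otimes>\<^bsub>X\<^esub> \<Psi> \<sigma> \<otimes>\<^bsub>X\<^esub> twist X \<Phi> \<sigma> b) \<otimes>\<^bsub>X\<^esub> \<Phi> \<sigma>"
      using \<sigma> b c by (simp add: translate_def twist_def m_assoc)
    moreover have "inv\<^bsub>X\<^esub> b \<otimes>\<^bsub>X\<^esub> \<Psi> \<sigma> \<otimes>\<^bsub>X\<^esub> twist X \<Phi> \<sigma> b \<in> carrier X"
      using b c by (simp add: twist_def)
    ultimately show ?thesis using \<sigma> c by (simp add: translate_def)
  qed
  then show ?thesis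
    using translate_in_Z1_iff[OF X \<Phi>] \<Psi> \<Lambda> by (simp add: cohomologous_def cong: conj_cong)
qed

lemma bij_betw_translate_Z1:
  assumes X: "definable_group M A X" and \<Phi>: "\<Phi> \<in> definable_Z1 M A X map"
  shows "bij_betw (translate M A X \<Phi>) (definable_Z1 M A X (twist X \<Phi>)) (definable_Z1 M A X map)"
proof -
  let ?C = "Aut M A \<rightarrow>\<^sub>E carrier X" and ?T = "translate M A X \<Phi>"
  have bij: "bij_betw ?T ?C ?C"
    using X \<Phi> by (intro bij_betw_translate) (auto simp: definable_group_def definable_Z1_iff)
  have sub: "definable_Z1 M A X act \<subseteq> ?C" for act by (auto simp: definable_Z1_def)
  have "?T ` definable_Z1 M A X (twist X \<Phi>) = definable_Z1 M A X map"
  proof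
    show "?T ` definable_Z1 M A X (twist X \<Phi>) \<subseteq> definable_Z1 M A X map"
      using translate_in_Z1_iff[OF X \<Phi>] sub by blast
    show "definable_Z1 M A X map \<subseteq> ?T ` definable_Z1 M A X (twist X \<Phi>)"
    proof
      fix \<Theta> assume \<Theta>: "\<Theta> \<in> definable_Z1 M A X map"
      then have "\<Theta> \<in> ?T ` ?C" using bij sub by (auto simp: bij_betw_def)
      then show "\<Theta> \<in> ?T ` definable_Z1 M A X (twist X \<Phi>)"
        using translate_in_Z1_iff[OF X \<Phi>] \<Theta> by blast
    qed
  qed
  then show ?thesis using bij sub by (intro bij_betw_subset[OF bij]) auto
qed

lemma translate_H1_class:
  assumes X: "definable_group M A X" and \<Phi>: "\<Phi> \<in> definable_Z1 M A X map"
    and \<Psi>: "\<Psi> \<in> Aut M A \<rightarrow>\<^sub>E carrier X"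
  shows "translate M A X \<Phi> ` H1_class M A X (twist X \<Phi>) \<Psi> = H1_class M A X map (translate M A X \<Phi> \<Psi>)"
    (is "?T ` ?L = ?R")
proof
  have sub: "definable_Z1 M A X act \<subseteq> Aut M A \<rightarrow>\<^sub>E carrier X" for act by (auto simp: definable_Z1_def)
  have cls: "\<Lambda> \<in> definable_Z1 M A X act" if "\<Lambda> \<in> H1_class M A X act \<Theta>" for \<Lambda> \<Theta> act
    using that by (auto simp: H1_class_def cohomologous_def)
  show "?T ` ?L \<subseteq> ?R"
  proof
    fix \<Theta> assume "\<Theta> \<in> ?T ` ?L"
    then obtain \<Lambda> where \<Lambda>: "\<Lambda> \<in> ?L" "\<Theta> = ?T \<Lambda>" by blast
    then have "\<Lambda> \<in> Aut M A \<rightarrow>\<^sub>E carrier X" using cls sub by blast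
    from translate_cohomologous_iff[OF X \<Phi> \<Psi> this] \<Lambda> show "\<Theta> \<in> ?R" by (simp add: H1_class_def)
  qed
  show "?R \<subseteq> ?T ` ?L"
  proof
    fix \<Theta> assume \<Theta>: "\<Theta> \<in> ?R"
    then obtain \<Lambda> where \<Lambda>: "\<Lambda> \<in> definable_Z1 M A X (twist X \<Phi>)" "\<Theta> = ?T \<Lambda>"
      using cls bij_betw_translate_Z1[OF X \<Phi>] unfolding bij_betw_def by blast
    then have "\<Lambda> \<in> Aut M A \<rightarrow>\<^sub>E carrier X" using sub by blast
    from translate_cohomologous_iff[OF X \<Phi> \<Psi> this] \<Theta> \<Lambda>(2) have "\<Lambda> \<in> ?L" by (simp add: H1_class_def)
    then show "\<Theta> \<in> ?T ` ?L" using \<Lambda>(2) by blast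
  qed
qed

lemma definable_H1_eq_image: "definable_H1 M A X act = H1_class M A X act ` definable_Z1 M A X act"
  by (auto simp: definable_H1_def quotient_def H1_class_def)

text \<open>Translation carries cocycles to cocycles bijectively and neither creates nor destroys
  cohomology, so it carries each class, as a set of cocycles, onto a class.\<close>

lemma bij_betw_translate_H1:
  assumes X: "definable_group M A X" and \<Phi>: "\<Phi> \<in> definable_Z1 M A X map"
  shows "bij_betw ((`) (translate M A X \<Phi>)) (definable_H1 M A X (twist X \<Phi>)) (definable_H1 M A X map)"
proof -
  let ?T = "translate M A X \<Phi>" and ?Z = "definable_Z1 M A X (twist X \<Phi>)"
  have T: "inj_on ?T ?Z" "?T ` ?Z = definable_Z1 M A X map"
    using bij_betw_translate_Z1[OF X \<Phi>] by (auto simp: bij_betw_def)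
  have "definable_H1 M A X (twist X \<Phi>) \<subseteq> Pow ?Z"
    by (auto simp: definable_H1_eq_image H1_class_def cohomologous_def)
  then have "inj_on ((`) ?T) (definable_H1 M A X (twist X \<Phi>))"
    using inj_on_image_Pow[OF T(1)] by (rule inj_on_subset[rotated])
  moreover have "(`) ?T ` definable_H1 M A X (twist X \<Phi>) = definable_H1 M A X map"
  proof -
    have "?T ` H1_class M A X (twist X \<Phi>) \<Psi> = H1_class M A X map (?T \<Psi>)" if "\<Psi> \<in> ?Z" for \<Psi>
      using that by (intro translate_H1_class[OF X \<Phi>]) (simp add: definable_Z1_def)
    then show ?thesis by (simp add: definable_H1_eq_image image_image flip: T(2))
  qed
  ultimately show ?thesis by (simp add: bij_betw_def)
qed

section \<open>Change of coefficients\<close>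

lemma compose_definable_Z1:
  assumes h: "definable_fun M A n k (carrier X) h" "h \<in> hom X Y"
    and X: "definable_group M A X" and \<Psi>: "\<Psi> \<in> definable_Z1 M A X map"
  shows "compose (Aut M A) h \<Psi> \<in> definable_Z1 M A Y map"
proof -
  have c: "\<Psi> \<sigma> \<in> carrier X" if "\<sigma> \<in> Aut M A" for \<sigma> using \<Psi> that by (auto simp: definable_Z1_iff)
  have "definable_cochain M A (\<lambda>\<sigma>. h (\<Psi> \<sigma>))"
    by (rule definable_cochain_comp[OF _ h(1) c]) (use \<Psi> in \<open>simp_all add: definable_Z1_iff\<close>)
  then have "definable_cochain M A (compose (Aut M A) h \<Psi>)"
    by (rule definable_cochain_cong) (simp add: compose_def)
  moreover have "compose (Aut M A) h \<Psi> \<in> Aut M A \<rightarrow>\<^sub>E carrier Y"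
    using c hom_in_carrier[OF h(2)] by (auto simp: compose_def)
  moreover have "compose (Aut M A) h \<Psi> (\<sigma> \<circ> \<tau>)
      = compose (Aut M A) h \<Psi> \<sigma> \<otimes>\<^bsub>Y\<^esub> map \<sigma> (compose (Aut M A) h \<Psi> \<tau>)"
    if \<sigma>: "\<sigma> \<in> Aut M A" and \<tau>: "\<tau> \<in> Aut M A" for \<sigma> \<tau>
  proof -
    have "\<Psi> (\<sigma> \<circ> \<tau>) = \<Psi> \<sigma> \<otimes>\<^bsub>X\<^esub> map \<sigma> (\<Psi> \<tau>)" using \<Psi> \<sigma> \<tau> by (simp add: definable_Z1_iff)
    then show ?thesis
      using \<sigma> \<tau> comp_in_Aut[OF \<sigma> \<tau>] hom_mult[OF h(2) c[OF \<sigma>]] definable_fun_Aut[OF h(1) \<sigma> c[OF \<tau>]]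
      by (simp add: compose_def)
  qed
  ultimately show ?thesis by (simp add: definable_Z1_iff)
qed

lemma H1_map_H1_class:
  assumes h: "definable_fun M A n k (carrier X) h" "h \<in> hom X Y"
    and X: "definable_group M A X" and Y: "definable_group M A Y"
    and \<Psi>: "\<Psi> \<in> definable_Z1 M A X map"
  shows "H1_map M A Y map h (H1_class M A X map \<Psi>) = H1_class M A Y map (compose (Aut M A) h \<Psi>)"
proof -
  have "H1_class M A Y map (compose (Aut M A) h \<Lambda>) = H1_class M A Y map (compose (Aut M A) h \<Psi>)"
    if "\<Lambda> \<in> H1_class M A X map \<Psi>" for \<Lambda>
  proof -
    have "(compose (Aut M A) h \<Psi>, compose (Aut M A) h \<Lambda>) \<in> cohomologous M A Y map"
      by (rule cohomologous_hom[OF h(2)])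
        (use that X Y definable_fun_Aut[OF h(1)] compose_definable_Z1[OF h X]
          in \<open>auto simp: H1_class_def definable_group_def\<close>)
    then show ?thesis
      unfolding H1_class_def by (rule equiv_class_eq[OF equiv_cohomologous[OF Y], symmetric])
  qed
  moreover have "\<Psi> \<in> H1_class M A X map \<Psi>"
    unfolding H1_class_def by (rule equiv_class_self[OF equiv_cohomologous[OF X] \<Psi>])
  ultimately show ?thesis unfolding H1_map_def by blast
qed

lemma compose_translate:
  assumes "h \<in> hom X Y" "\<Phi> \<in> Aut M A \<rightarrow>\<^sub>E carrier X" "\<Psi> \<in> Aut M A \<rightarrow>\<^sub>E carrier X"
  shows "compose (Aut M A) h (translate M A X \<Phi> \<Psi>)
    = translate M A Y (compose (Aut M A) h \<Phi>) (compose (Aut M A) h \<Psi>)"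
  using assms by (auto simp: fun_eq_iff compose_def translate_def restrict_def intro!: hom_mult)

text \<open>This is the commutative square relating the twisted map \<open>\<pi>\<^sup>1\<^sub>\<Phi>\<close> to \<open>\<pi>\<^sup>1\<close>, with the
  translations by \<open>\<Phi>\<close> and by \<open>\<pi> \<circ> \<Phi>\<close> as vertical arrows. It holds class by class, and the
  union over representatives in the definition of \<open>H1_map\<close> commutes with images.\<close>

lemma H1_map_translate:
  assumes h: "definable_fun M A n k (carrier X) h" "h \<in> hom X Y"
    and X: "definable_group M A X" and Y: "definable_group M A Y"
    and \<Phi>: "\<Phi> \<in> definable_Z1 M A X map" and \<nu>: "\<nu> \<subseteq> definable_Z1 M A X (twist X \<Phi>)"
  defines "\<Phi>' \<equiv> compose (Aut M A) h \<Phi>"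
  shows "H1_map M A Y map h (translate M A X \<Phi> ` \<nu>) = translate M A Y \<Phi>' ` H1_map M A Y (twist Y \<Phi>') h \<nu>"
proof -
  have "H1_class M A Y map (compose (Aut M A) h (translate M A X \<Phi> \<Psi>))
      = translate M A Y \<Phi>' ` H1_class M A Y (twist Y \<Phi>') (compose (Aut M A) h \<Psi>)" if "\<Psi> \<in> \<nu>" for \<Psi>
  proof -
    have c: "\<Psi> \<in> Aut M A \<rightarrow>\<^sub>E carrier X" "\<Phi> \<in> Aut M A \<rightarrow>\<^sub>E carrier X"
      using \<nu> that \<Phi> by (auto simp: definable_Z1_def)
    then have "compose (Aut M A) h \<Psi> \<in> Aut M A \<rightarrow>\<^sub>E carrier Y"
      using hom_in_carrier[OF h(2)] by (auto simp: compose_def)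
    from translate_H1_class[OF Y compose_definable_Z1[OF h X \<Phi>] this]
    show ?thesis by (simp add: compose_translate[OF h(2) c(2,1)] \<Phi>'_def)
  qed
  then show ?thesis by (simp add: H1_map_def image_UN)
qed

theorem corollary3p4:
  fixes M :: "('f, 'r, 'm) fo_structure" and A :: "'m set"
    and G Q :: "'m list monoid" and N :: "'m list set"
    and \<pi> :: "'m list \<Rightarrow> 'm list" and \<Phi> :: "('m \<Rightarrow> 'm) \<Rightarrow> 'm list"
  assumes "atomic_over M A" and "homogeneous_over M A" and "eliminates_imaginaries M"
    and "definable_group M A G" and "definable_normal_subgroup M A G N"
    and "definable_quotient M A G N Q \<pi>"
    and "\<Phi> \<in> definable_Z1 M A G map"
  shows "let
      \<G> = Aut M A;
      \<pi>1 = H1_map M A Q map \<pi>;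
      \<pi>1\<^sub>\<Phi> = H1_map M A Q (twist Q (compose \<G> \<pi> \<Phi>)) \<pi>;
      ker = {\<nu> \<in> definable_H1 M A G (twist G \<Phi>). \<pi>1\<^sub>\<Phi> \<nu> = H1_point M A Q (twist Q (compose \<G> \<pi> \<Phi>))};
      \<mu> = H1_class M A G map \<Phi>;
      fibre = {\<nu> \<in> definable_H1 M A G map. \<pi>1 \<nu> = \<pi>1 \<mu>}
    in \<exists>F. bij_betw F ker fibre
         \<and> (\<forall>\<Psi>\<in>definable_Z1 M A G (twist G \<Phi>). H1_class M A G (twist G \<Phi>) \<Psi> \<in> ker \<longrightarrow>
              F (H1_class M A G (twist G \<Phi>) \<Psi>) = H1_class M A G map (\<lambda>\<sigma>\<in>\<G>. \<Psi> \<sigma> \<otimes>\<^bsub>G\<^esub> \<Phi> \<sigma>))"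
proof -
  note G = assms(4) and \<Phi> = assms(7)
  from assms(6) obtain n k where Q: "definable_group M A Q"
    and \<pi>: "definable_fun M A n k (carrier G) \<pi>" "\<pi> \<in> hom G Q"
    by (auto simp: definable_quotient_def epi_def)
  interpret Q: group Q using Q by (simp add: definable_group_def)
  define \<Phi>Q where "\<Phi>Q = compose (Aut M A) \<pi> \<Phi>"
  have \<Phi>Q: "\<Phi>Q \<in> definable_Z1 M A Q map" unfolding \<Phi>Q_def by (rule compose_definable_Z1[OF \<pi> G \<Phi>])
  let ?H = "definable_H1 M A G (twist G \<Phi>)"
  let ?T = "translate M A G \<Phi>" and ?TQ = "translate M A Q \<Phi>Q"
  let ?\<pi>1 = "H1_map M A Q map \<pi>" and ?\<pi>1\<^sub>\<Phi> = "H1_map M A Q (twist Q \<Phi>Q) \<pi>"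
  let ?pt = "H1_point M A Q (twist Q \<Phi>Q)"
  have \<nu>Z: "\<nu> \<subseteq> definable_Z1 M A G (twist G \<Phi>)" if "\<nu> \<in> ?H" for \<nu>
    using that by (auto simp: definable_H1_eq_image H1_class_def cohomologous_def)
  \<comment> \<open>Translation by \<open>\<pi> \<circ> \<Phi>\<close> sends the trivial twisted cocycle to \<open>\<pi> \<circ> \<Phi>\<close> itself, hence the
    distinguished point to \<open>\<pi>\<^sup>1(\<mu>)\<close>.\<close>
  have "\<Phi>Q \<in> Aut M A \<rightarrow>\<^sub>E carrier Q" using \<Phi>Q by (simp add: definable_Z1_def)
  then have \<Phi>Qc: "\<Phi>Q \<sigma> \<in> carrier Q" if "\<sigma> \<in> Aut M A" for \<sigma> using that by (rule PiE_mem)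
  have "?TQ (\<lambda>\<sigma>\<in>Aut M A. \<one>\<^bsub>Q\<^esub>) \<sigma> = \<Phi>Q \<sigma>" for \<sigma>
    using \<Phi>Qc[of \<sigma>] by (cases "\<sigma> \<in> Aut M A") (simp_all add: translate_def \<Phi>Q_def compose_def)
  then have "?TQ (\<lambda>\<sigma>\<in>Aut M A. \<one>\<^bsub>Q\<^esub>) = \<Phi>Q" by (rule ext)
  moreover have "(\<lambda>\<sigma>\<in>Aut M A. \<one>\<^bsub>Q\<^esub>) \<in> Aut M A \<rightarrow>\<^sub>E carrier Q" by auto
  ultimately have "?TQ ` ?pt = H1_class M A Q map \<Phi>Q"
    using translate_H1_class[OF Q \<Phi>Q, of "\<lambda>\<sigma>\<in>Aut M A. \<one>\<^bsub>Q\<^esub>"] by (simp only: H1_point_def)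
  then have pt: "?TQ ` ?pt = ?\<pi>1 (H1_class M A G map \<Phi>)"
    using H1_map_H1_class[OF \<pi> G Q \<Phi>] by (simp only: \<Phi>Q_def)
  have iff: "?\<pi>1 (?T ` \<nu>) = ?\<pi>1 (H1_class M A G map \<Phi>) \<longleftrightarrow> ?\<pi>1\<^sub>\<Phi> \<nu> = ?pt" if "\<nu> \<in> ?H" for \<nu>
  proof -
    \<comment> \<open>Translation in the quotient is injective on cocycles, so equality of sets of cocycles may be
      tested after translating.\<close>
    have inj: "inj_on ?TQ (definable_Z1 M A Q (twist Q \<Phi>Q))"
      using bij_betw_translate_Z1[OF Q \<Phi>Q] by (simp add: bij_betw_def)
    have "?\<pi>1\<^sub>\<Phi> \<nu> \<subseteq> definable_Z1 M A Q (twist Q \<Phi>Q)" "?pt \<subseteq> definable_Z1 M A Q (twist Q \<Phi>Q)"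
      by (auto simp: H1_map_def H1_point_def H1_class_def cohomologous_def)
    then have "?\<pi>1\<^sub>\<Phi> \<nu> = ?pt \<longleftrightarrow> ?TQ ` ?\<pi>1\<^sub>\<Phi> \<nu> = ?TQ ` ?pt"
      by (rule inj_on_image_eq_iff[OF inj, symmetric])
    also have "?TQ ` ?\<pi>1\<^sub>\<Phi> \<nu> = ?\<pi>1 (?T ` \<nu>)"
      using H1_map_translate[OF \<pi> G Q \<Phi> \<nu>Z[OF that]] by (simp only: \<Phi>Q_def)
    finally show ?thesis by (simp only: pt)
  qed
  have "bij_betw ((`) ?T) {\<nu> \<in> ?H. ?\<pi>1\<^sub>\<Phi> \<nu> = ?pt}
      {\<nu> \<in> definable_H1 M A G map. ?\<pi>1 \<nu> = ?\<pi>1 (H1_class M A G map \<Phi>)}"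
    by (rule bij_betw_Collect[OF bij_betw_translate_H1[OF G \<Phi>]]) (rule iff)
  moreover have "?T ` H1_class M A G (twist G \<Phi>) \<Psi>
      = H1_class M A G map (\<lambda>\<sigma>\<in>Aut M A. \<Psi> \<sigma> \<otimes>\<^bsub>G\<^esub> \<Phi> \<sigma>)"
    if "\<Psi> \<in> definable_Z1 M A G (twist G \<Phi>)" for \<Psi>
    using translate_H1_class[OF G \<Phi>, of \<Psi>] that by (simp add: definable_Z1_def translate_def)
  ultimately show ?thesis
    unfolding Let_def \<Phi>Q_def[symmetric] by (intro exI[of _ "(`) ?T"] conjI ballI impI)
qed

end
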